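(* Let $k$ be a constant and let $G=(V,E)$ be a graph with $n$ vertices and treewidth at most $k$. Then the number of isomorphism classes of good pairs of $G$ is $2^{O(n/\log n)}$.
   Context: All graphs are finite, simple and undirected; $N(v)$ denotes the set of neighbours of $v$. The treewidth of $G$ is the minimum width of a tree decomposition of $G$ (a tree decomposition is a tree $T$ with bags $X_i\subseteq V$ covering $V$ and every edge, such that for each vertex the bags containing it induce a connected subtree; its width is the maximum bag size minus one). A good pair of $G$ is a pair $(X,W)$ of subsets of $V$ such that $|X|\leq k+1$, $X\cap W=\emptyset$, and $N(v)\subseteq W\cup X$ for all $v\in W$ (equivalently, $W$ is a union of zero or more connected components of $G[V\setminus X]$). Two good pairs $(X,W)$ and $(X',Z)$ are isomorphic if $X=X'$ and there is a bijection $f: X\cup W\to X\cup Z$ with $f(v)=v$ for all $v\in X$ and, for all $v,w\in X\cup W$, $\{v,w\}\in E \Leftrightarrow \{f(v),f(w)\}\in E$. *)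

theory Defs
  imports Complex_Main "HOL-Library.Landau_Symbols"
begin

definition simple_graph :: "'a set \<Rightarrow> 'a set set \<Rightarrow> bool" where
  "simple_graph V E \<longleftrightarrow> finite V \<and> (\<forall>e\<in>E. e \<subseteq> V \<and> card e = 2)"

definition neighbours :: "'a set set \<Rightarrow> 'a \<Rightarrow> 'a set" where
  "neighbours E v = {u. {v, u} \<in> E}"

text \<open>Connectedness of the subgraph induced by the vertex set \<open>S\<close>.\<close>

definition induces_connected :: "'a set set \<Rightarrow> 'a set \<Rightarrow> bool" where
  "induces_connected E S \<longleftrightarrow>
     (\<forall>u\<in>S. \<forall>v\<in>S. (u, v) \<in> {(x, y). x \<in> S \<and> y \<in> S \<and> {x, y} \<in> E}\<^sup>*)"

definition is_cycle :: "'a set set \<Rightarrow> 'a list \<Rightarrow> bool" where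
  "is_cycle E xs \<longleftrightarrow> 3 \<le> length xs \<and> distinct xs \<and>
     (\<forall>i<length xs. {xs ! i, xs ! (Suc i mod length xs)} \<in> E)"

definition is_tree :: "'a set \<Rightarrow> 'a set set \<Rightarrow> bool" where
  "is_tree V E \<longleftrightarrow> simple_graph V E \<and> V \<noteq> {} \<and> induces_connected E V \<and> (\<nexists>xs. is_cycle E xs)"

definition tree_decomposition ::
  "'a set \<Rightarrow> 'a set set \<Rightarrow> 'i set \<Rightarrow> 'i set set \<Rightarrow> ('i \<Rightarrow> 'a set) \<Rightarrow> bool" where
  "tree_decomposition V E I F B \<longleftrightarrow>
     is_tree I F \<and>
     (\<forall>i\<in>I. B i \<subseteq> V) \<and>
     (\<forall>v\<in>V. \<exists>i\<in>I. v \<in> B i) \<and>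
     (\<forall>e\<in>E. \<exists>i\<in>I. e \<subseteq> B i) \<and>
     (\<forall>v\<in>V. induces_connected F {i \<in> I. v \<in> B i})"

definition decomposition_width :: "'i set \<Rightarrow> ('i \<Rightarrow> 'a set) \<Rightarrow> int" where
  "decomposition_width I B = int (Max ((\<lambda>i. card (B i)) ` I)) - 1"

text \<open>
  Decomposition trees are finite, so taking their nodes from \<^typ>\<open>nat\<close> is no restriction.
  The width is an integer: the empty graph has treewidth \<open>-1\<close>.
\<close>

definition treewidth :: "'a set \<Rightarrow> 'a set set \<Rightarrow> int" where
  "treewidth V E =
     (LEAST w. \<exists>(I :: nat set) F B. tree_decomposition V E I F B \<and> w = decomposition_width I B)"

definition good_pairs :: "nat \<Rightarrow> 'a set \<Rightarrow> 'a set set \<Rightarrow> ('a set \<times> 'a set) set" where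
  "good_pairs k V E =
     {(X, W). X \<subseteq> V \<and> W \<subseteq> V \<and> card X \<le> k + 1 \<and> X \<inter> W = {} \<and>
              (\<forall>v\<in>W. neighbours E v \<subseteq> W \<union> X)}"

definition good_pair_iso ::
  "nat \<Rightarrow> 'a set \<Rightarrow> 'a set set \<Rightarrow> (('a set \<times> 'a set) \<times> ('a set \<times> 'a set)) set" where
  "good_pair_iso k V E =
     {((X, W), (X', Z)). (X, W) \<in> good_pairs k V E \<and> (X', Z) \<in> good_pairs k V E \<and> X = X' \<and>
        (\<exists>f. bij_betw f (X \<union> W) (X \<union> Z) \<and> (\<forall>v\<in>X. f v = v) \<and>
             (\<forall>v\<in>X \<union> W. \<forall>w\<in>X \<union> W. {v, w} \<in> E \<longleftrightarrow> {f v, f w} \<in> E))}"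

lemma good_pair_isoI:
  assumes "(X, W) \<in> good_pairs k V E" "(X, Z) \<in> good_pairs k V E"
    and "bij_betw f (X \<union> W) (X \<union> Z)" "\<forall>v\<in>X. f v = v"
    and "\<forall>v\<in>X \<union> W. \<forall>w\<in>X \<union> W. {v, w} \<in> E \<longleftrightarrow> {f v, f w} \<in> E"
  shows "((X, W), (X, Z)) \<in> good_pair_iso k V E"
  using assms unfolding good_pair_iso_def by blast

lemma good_pair_isoE:
  assumes "(p, q) \<in> good_pair_iso k V E"
  obtains X W Z f where "p = (X, W)" "q = (X, Z)"
    "(X, W) \<in> good_pairs k V E" "(X, Z) \<in> good_pairs k V E"
    "bij_betw f (X \<union> W) (X \<union> Z)" "\<forall>v\<in>X. f v = v"
    "\<forall>v\<in>X \<union> W. \<forall>w\<in>X \<union> W. {v, w} \<in> E \<longleftrightarrow> {f v, f w} \<in> E"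
  using assms unfolding good_pair_iso_def by blast

lemma equiv_good_pair_iso: "equiv (good_pairs k V E) (good_pair_iso k V E)"
proof (rule equivI)
  show "good_pair_iso k V E \<subseteq> good_pairs k V E \<times> good_pairs k V E"
    unfolding good_pair_iso_def by blast
  show "refl_on (good_pairs k V E) (good_pair_iso k V E)"
  proof (rule refl_onI)
    fix p assume "p \<in> good_pairs k V E"
    then show "(p, p) \<in> good_pair_iso k V E"
      by (cases p) (auto intro!: good_pair_isoI[where f = "\<lambda>x. x"] simp: bij_betw_def)
  qed
  show "sym (good_pair_iso k V E)"
  proof (rule symI)
    fix p q assume "(p, q) \<in> good_pair_iso k V E"
    then obtain X W Z f where h: "p = (X, W)" "q = (X, Z)"
      "(X, W) \<in> good_pairs k V E" "(X, Z) \<in> good_pairs k V E"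
      and f: "bij_betw f (X \<union> W) (X \<union> Z)" and fX: "\<forall>v\<in>X. f v = v"
      and fE: "\<forall>v\<in>X \<union> W. \<forall>w\<in>X \<union> W. {v, w} \<in> E \<longleftrightarrow> {f v, f w} \<in> E"
      by (rule good_pair_isoE)
    define g where "g = inv_into (X \<union> W) f"
    have g: "bij_betw g (X \<union> Z) (X \<union> W)" unfolding g_def using f by (rule bij_betw_inv_into)
    have fg: "f (g y) = y" "g y \<in> X \<union> W" if "y \<in> X \<union> Z" for y
      using that bij_betw_inv_into_right[OF f] bij_betw_apply[OF g] unfolding g_def by auto
    have gX: "\<forall>v\<in>X. g v = v"
      using f fX by (metis UnI1 bij_betw_inv_into_left g_def)
    have gE: "\<forall>v\<in>X \<union> Z. \<forall>w\<in>X \<union> Z. {v, w} \<in> E \<longleftrightarrow> {g v, g w} \<in> E"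
    proof (intro ballI)
      fix v w assume "v \<in> X \<union> Z" "w \<in> X \<union> Z"
      then show "{v, w} \<in> E \<longleftrightarrow> {g v, g w} \<in> E"
        using fE[rule_format, OF fg(2) fg(2), of v w] fg(1)[of v] fg(1)[of w] by simp
    qed
    show "(q, p) \<in> good_pair_iso k V E"
      using good_pair_isoI[OF h(4) h(3) g gX gE] h by simp
  qed
  show "trans (good_pair_iso k V E)"
  proof (rule transI)
    fix p q r assume pq: "(p, q) \<in> good_pair_iso k V E" and qr: "(q, r) \<in> good_pair_iso k V E"
    from pq obtain X W Z f where h: "p = (X, W)" "q = (X, Z)"
      "(X, W) \<in> good_pairs k V E"
      and f: "bij_betw f (X \<union> W) (X \<union> Z)" "\<forall>v\<in>X. f v = v"
      "\<forall>v\<in>X \<union> W. \<forall>w\<in>X \<union> W. {v, w} \<in> E \<longleftrightarrow> {f v, f w} \<in> E"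
      by (elim good_pair_isoE)
    from qr obtain X' Z' Y g where k': "q = (X', Z')" "r = (X', Y)" "(X', Y) \<in> good_pairs k V E"
      and g': "bij_betw g (X' \<union> Z') (X' \<union> Y)" "\<forall>v\<in>X'. g v = v"
      "\<forall>v\<in>X' \<union> Z'. \<forall>w\<in>X' \<union> Z'. {v, w} \<in> E \<longleftrightarrow> {g v, g w} \<in> E"
      by (elim good_pair_isoE)
    have "X' = X" "Z' = Z" using h(2) k'(1) by auto
    note k = k'(2,3)[unfolded this] and g = g'[unfolded this]
    have fin: "f v \<in> X \<union> Z" if "v \<in> X \<union> W" for v using f(1) that by (rule bij_betw_apply)
    have "((X, W), (X, Y)) \<in> good_pair_iso k V E"
    proof (rule good_pair_isoI[where f = "\<lambda>v. g (f v)"])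
      show "bij_betw (\<lambda>v. g (f v)) (X \<union> W) (X \<union> Y)"
        using bij_betw_trans[OF f(1) g(1)] by (simp add: comp_def)
      show "\<forall>v\<in>X. g (f v) = v" using f(2) g(2) by simp
      show "\<forall>v\<in>X \<union> W. \<forall>w\<in>X \<union> W. {v, w} \<in> E \<longleftrightarrow> {g (f v), g (f w)} \<in> E"
        using f(3) g(3) fin by simp
    qed (use h k in auto)
    then show "(p, r) \<in> good_pair_iso k V E" using h k by simp
  qed
qed

lemma finite_good_pair_classes:
  assumes "finite V"
  shows "finite (good_pairs k V E // good_pair_iso k V E)"
proof (rule finite_quotient)
  have "good_pairs k V E \<subseteq> Pow V \<times> Pow V" unfolding good_pairs_def by auto
  then show "finite (good_pairs k V E)" using assms by (meson finite_Pow_iff finite_SigmaI finite_subset)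
  show "good_pair_iso k V E \<subseteq> good_pairs k V E \<times> good_pairs k V E"
    unfolding good_pair_iso_def by blast
qed

lemma treewidth_attained:
  assumes "simple_graph V E"
  shows "\<exists>(I :: nat set) F B. tree_decomposition V E I F B \<and> treewidth V E = decomposition_width I B"
    and "\<And>(I :: nat set) F B. tree_decomposition V E I F B \<Longrightarrow> treewidth V E \<le> decomposition_width I B"
proof -
  define P where "P w \<longleftrightarrow>
    (\<exists>(I :: nat set) F B. tree_decomposition V E I F B \<and> w = decomposition_width I B)" for w
  define Q where "Q n \<longleftrightarrow> P (int n - 1)" for n
  have ge: "\<exists>n. w = int n - 1" if "P w" for w
    using that unfolding P_def decomposition_width_def by blast
  have "\<not> is_cycle {} xs" for xs :: "nat list"
    unfolding is_cycle_def by (metis empty_iff le_zero_eq not_gr_zero zero_neq_numeral)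
  then have "is_tree {0 :: nat} {}"
    by (auto simp: is_tree_def simple_graph_def induces_connected_def)
  moreover have "induces_connected {} {0 :: nat}"
    by (auto simp: induces_connected_def)
  ultimately have "tree_decomposition V E {0 :: nat} {} (\<lambda>_. V)"
    using assms by (auto simp: tree_decomposition_def simple_graph_def)
  then have "Q (card V)"
    unfolding Q_def P_def decomposition_width_def
    by (intro exI[of _ "{0 :: nat}"] exI[of _ "{}"] exI[of _ "\<lambda>_. V"]) simp
  then have least: "Q (Least Q)" "\<And>n. Q n \<Longrightarrow> Least Q \<le> n"
    by (rule LeastI) (rule Least_le)
  have tw: "treewidth V E = int (Least Q) - 1"
    unfolding treewidth_def P_def[symmetric]
  proof (rule Least_equality)
    show "P (int (Least Q) - 1)" using least(1) by (simp only: Q_def)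
    fix w assume w: "P w"
    then obtain n where n: "w = int n - 1" using ge by blast
    with w have "Q n" by (simp only: Q_def)
    then have "Least Q \<le> n" by (rule least(2))
    then show "int (Least Q) - 1 \<le> w" using n by simp
  qed
  show "\<exists>(I :: nat set) F B. tree_decomposition V E I F B \<and> treewidth V E = decomposition_width I B"
    using least(1) tw unfolding Q_def[of "Least Q"] P_def by simp
  fix I :: "nat set" and F B assume "tree_decomposition V E I F B"
  then have P: "P (decomposition_width I B)" unfolding P_def by blast
  then obtain n where "decomposition_width I B = int n - 1" using ge by blast
  with P have "Q n" by (simp only: Q_def)
  then have "Least Q \<le> n" by (rule least(2))
  then show "treewidth V E \<le> decomposition_width I B"
    using tw \<open>decomposition_width I B = int n - 1\<close> by simp
qed

end

theory Submission
  imports Defs "HOL-Library.FuncSet" "HOL-Real_Asymp.Real_Asymp"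
begin

text \<open>
  There are only \<open>(n + 1) ^ (k + 1)\<close> choices for \<open>X\<close>. For fixed \<open>X\<close>, the set \<open>W\<close> is a union of
  components of \<open>G - X\<close>, and the class of \<open>(X, W)\<close> is determined by how many components of each
  isomorphism type (relative to \<open>X\<close>) it contains. Adding \<open>X\<close> to every bag of a tree decomposition
  shows that a component with \<open>c\<close> vertices is described up to isomorphism by a term of length
  \<open>O(c)\<close> over an alphabet depending only on \<open>k\<close>, so components with at most \<open>s\<close> vertices have
  \<open>2 ^ O(s)\<close> types. With \<open>s = \<delta> ln n\<close> for small \<open>\<delta>\<close> there are \<open>O(sqrt n)\<close> such types, hence
  \<open>(n + 1) ^ O(sqrt n)\<close> multiplicity vectors, and at most \<open>n / s\<close> larger components, for which
  one simply records which of them lie in \<open>W\<close>.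
\<close>

subsection \<open>Isomorphisms of induced subgraphs\<close>

definition graph_iso :: "'a set set \<Rightarrow> ('a \<Rightarrow> 'a) \<Rightarrow> 'a set \<Rightarrow> 'a set \<Rightarrow> bool" where
  "graph_iso E f U U' \<longleftrightarrow>
     bij_betw f U U' \<and> (\<forall>v\<in>U. \<forall>w\<in>U. {v, w} \<in> E \<longleftrightarrow> {f v, f w} \<in> E)"

text \<open>The usual notion of a separation of the graph induced on \<open>A \<union> B\<close>:
  each of its edges lies inside \<open>A\<close> or inside \<open>B\<close>.\<close>

definition no_cross_edges :: "'a set set \<Rightarrow> 'a set \<Rightarrow> 'a set \<Rightarrow> bool" where
  "no_cross_edges E A B \<longleftrightarrow> (\<forall>u\<in>A - B. \<forall>w\<in>B - A. {u, w} \<notin> E)"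

text \<open>Positions stand in for vertices, so patterns of different vertex lists can be compared,
  and only finitely many occur once the length is bounded.\<close>

definition adjacency_pattern :: "'a set set \<Rightarrow> 'a list \<Rightarrow> (nat \<times> nat) set" where
  "adjacency_pattern E xs = {(i, j). i < length xs \<and> j < length xs \<and> {xs ! i, xs ! j} \<in> E}"

definition coincidences :: "'a list \<Rightarrow> 'a list \<Rightarrow> (nat \<times> nat) set" where
  "coincidences xs ys = {(i, j). i < length xs \<and> j < length ys \<and> xs ! i = ys ! j}"

text \<open>As both sides are separations, every edge is handled by \<open>f\<close> alone or by
  \<open>g\<close> alone. The hypothesis on \<open>A' \<inter> B'\<close> makes the images overlap
  only where the sources do, which gives injectivity of the glued map.\<close>

lemma graph_iso_glue:
  assumes f: "graph_iso E f A A'" and g: "graph_iso E g B B'"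
    and agree: "\<And>v. v \<in> A \<Longrightarrow> v \<in> B \<Longrightarrow> f v = g v"
    and meet: "A' \<inter> B' \<subseteq> f ` (A \<inter> B)"
    and sep: "no_cross_edges E A B" and sep': "no_cross_edges E A' B'"
  obtains h where "graph_iso E h (A \<union> B) (A' \<union> B')"
    "\<And>v. v \<in> A \<Longrightarrow> h v = f v" "\<And>v. v \<in> B \<Longrightarrow> h v = g v"
proof
  define h where "h v = (if v \<in> A then f v else g v)" for v
  show hA: "h v = f v" if "v \<in> A" for v using that by (simp add: h_def)
  show hB: "h v = g v" if "v \<in> B" for v using that agree by (simp add: h_def)
  have fb: "bij_betw f A A'" and gb: "bij_betw g B B'"
    using f g by (auto simp: graph_iso_def)
  have fA: "f ` A = A'" "g ` B = B'" using fb gb by (auto simp: bij_betw_def)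
  have finj: "inj_on f A" "inj_on g B" using fb gb by (auto simp: bij_betw_def)
  \<comment> \<open>An image of \<open>B - A\<close> inside \<open>A'\<close> would lie in
    \<open>A' \<inter> B'\<close>, hence be the \<open>g\<close>-image of a common vertex, against
    injectivity of \<open>g\<close>.\<close>
  have gout: "g w \<in> B' - A'" if "w \<in> B - A" for w
  proof -
    have "g w \<notin> A'"
    proof
      assume "g w \<in> A'"
      then have "g w \<in> f ` (A \<inter> B)" using meet fA that by blast
      then obtain u where "u \<in> A" "u \<in> B" "g w = g u" using agree by auto
      then show False using finj(2) that by (metis DiffE inj_onD)
    qed
    then show ?thesis using fA that by blast
  qed
  have fout: "f w \<in> A' - B'" if "w \<in> A - B" for w
  proof -
    have "f w \<notin> B'"
    proof
      assume "f w \<in> B'"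
      then have "f w \<in> f ` (A \<inter> B)" using meet fA that by blast
      then obtain u where "u \<in> A" "u \<in> B" "f w = f u" by auto
      then show False using finj(1) that by (metis DiffE inj_onD)
    qed
    then show ?thesis using fA that by blast
  qed
  have "inj_on h (A \<union> B)"
  proof (rule inj_onI)
    fix v w assume *: "v \<in> A \<union> B" "w \<in> A \<union> B" "h v = h w"
    consider "v \<in> A" "w \<in> A" | "v \<in> B" "w \<in> B" | "v \<in> A" "w \<in> B - A" | "w \<in> A" "v \<in> B - A"
      using *(1,2) by blast
    then show "v = w"
    proof cases
      case 1 then show ?thesis using *(3) hA finj(1) by (metis inj_onD)
    next
      case 2 then show ?thesis using *(3) hB finj(2) by (metis inj_onD)
    next
      case 3
      then have "f v = g w" using *(3) hA hB by simp
      moreover have "f v \<in> A'" using 3 fA(1) by blast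
      ultimately show ?thesis using gout[OF 3(2)] by simp
    next
      case 4
      then have "f w = g v" using *(3) hA hB by simp
      moreover have "f w \<in> A'" using 4 fA(1) by blast
      ultimately show ?thesis using gout[OF 4(2)] by simp
    qed
  qed
  moreover have "h ` (A \<union> B) = A' \<union> B'"
  proof -
    have "h ` A = f ` A" "h ` B = g ` B" by (intro image_cong hA hB refl; assumption)+
    then show ?thesis using fA by (simp add: image_Un)
  qed
  moreover have "{v, w} \<in> E \<longleftrightarrow> {h v, h w} \<in> E" if "v \<in> A \<union> B" "w \<in> A \<union> B" for v w
  proof -
    consider "v \<in> A" "w \<in> A" | "v \<in> B" "w \<in> B" | "v \<in> A - B" "w \<in> B - A" | "w \<in> A - B" "v \<in> B - A"
      using \<open>v \<in> A \<union> B\<close> \<open>w \<in> A \<union> B\<close> by blast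
    then show ?thesis
    proof cases
      case 1 then show ?thesis using f hA by (simp add: graph_iso_def)
    next
      case 2 then show ?thesis using g hB by (simp add: graph_iso_def)
    next
      case 3
      then have "{v, w} \<notin> E" using sep unfolding no_cross_edges_def by blast
      moreover have "{f v, g w} \<notin> E"
        using sep' fout[OF 3(1)] gout[OF 3(2)] unfolding no_cross_edges_def by blast
      then have "{h v, h w} \<notin> E" using 3 hA hB by simp
      ultimately show ?thesis by simp
    next
      case 4
      then have "{w, v} \<notin> E" using sep unfolding no_cross_edges_def by blast
      moreover have "{f w, g v} \<notin> E"
        using sep' fout[OF 4(1)] gout[OF 4(2)] unfolding no_cross_edges_def by blast
      then have "{h w, h v} \<notin> E" using 4 hA hB by simp
      ultimately show ?thesis by (simp add: insert_commute)
    qed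
  qed
  ultimately show "graph_iso E h (A \<union> B) (A' \<union> B')"
    unfolding graph_iso_def bij_betw_def by simp
qed

lemma graph_iso_lists:
  assumes "distinct xs" "distinct ys" and len: "length xs = length ys"
    and pat: "adjacency_pattern E xs = adjacency_pattern E ys"
  obtains f where "graph_iso E f (set xs) (set ys)" "map f xs = ys"
proof
  define f where "f = (\<lambda>v. ys ! (THE i. i < length xs \<and> xs ! i = v))"
  have f: "f (xs ! i) = ys ! i" if "i < length xs" for i
  proof -
    have "(THE j. j < length xs \<and> xs ! j = xs ! i) = i"
      using that assms(1) by (auto simp: nth_eq_iff_index_eq)
    then show ?thesis by (simp add: f_def)
  qed
  show m: "map f xs = ys" using len f by (auto intro: nth_equalityI)
  have "bij_betw f (set xs) (set ys)"
    using m assms(1,2) by (auto simp: bij_betw_def distinct_map)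
  moreover have "{v, w} \<in> E \<longleftrightarrow> {f v, f w} \<in> E" if "v \<in> set xs" "w \<in> set xs" for v w
  proof -
    obtain i j where ij: "i < length xs" "j < length xs" "v = xs ! i" "w = xs ! j"
      using \<open>v \<in> set xs\<close> \<open>w \<in> set xs\<close> unfolding in_set_conv_nth by blast
    have "(i, j) \<in> adjacency_pattern E xs \<longleftrightarrow> (i, j) \<in> adjacency_pattern E ys" using pat by simp
    then show ?thesis using ij f len by (simp add: adjacency_pattern_def)
  qed
  ultimately show "graph_iso E f (set xs) (set ys)" by (simp add: graph_iso_def)
qed

subsection \<open>Codes for graphs with an ordered boundary\<close>

text \<open>
  Terms building a graph \<open>U\<close> with an ordered list of boundary vertices \<open>xs\<close>, in the manner of a
  tree decomposition read from the leaves to the root. A label records the length of the boundary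
  list, its induced subgraph, and (for \<open>Shift\<close>) its overlap with the previous boundary list.
\<close>

type_synonym label = "nat \<times> (nat \<times> nat) set \<times> (nat \<times> nat) set"

datatype 's code = Leaf 's | Shift 's "'s code" | Join "'s code" "'s code"

text \<open>The side conditions of \<open>Shift\<close> and \<open>Join\<close> mirror a tree
  decomposition: parts meet only in boundary vertices, and no edge runs between them outside their
  overlap. The third component of a \<open>Leaf\<close> label is a mere placeholder.\<close>

fun describes :: "'a set set \<Rightarrow> label code \<Rightarrow> 'a list \<Rightarrow> 'a set \<Rightarrow> bool" where
  "describes E (Leaf s) ys U \<longleftrightarrow>
     distinct ys \<and> U = set ys \<and> s = (length ys, adjacency_pattern E ys, {})"
| "describes E (Shift s t) ys U \<longleftrightarrow>
     distinct ys \<and>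
     (\<exists>xs U'. describes E t xs U' \<and> U = U' \<union> set ys \<and> U' \<inter> set ys \<subseteq> set xs \<and>
        no_cross_edges E U' (set ys) \<and>
        s = (length ys, adjacency_pattern E ys, coincidences xs ys))"
| "describes E (Join t\<^sub>1 t\<^sub>2) ys U \<longleftrightarrow>
     (\<exists>U\<^sub>1 U\<^sub>2. describes E t\<^sub>1 ys U\<^sub>1 \<and> describes E t\<^sub>2 ys U\<^sub>2 \<and> U = U\<^sub>1 \<union> U\<^sub>2 \<and>
        U\<^sub>1 \<inter> U\<^sub>2 = set ys \<and> no_cross_edges E U\<^sub>1 U\<^sub>2)"

lemma describes_boundary_subset: "describes E t xs U \<Longrightarrow> set xs \<subseteq> U"
  by (induction t arbitrary: xs U) auto

text \<open>Induction on the term, gluing the isomorphisms of the parts. The claim about the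
  boundary lists makes these agree on the overlap; applied with \<open>xs = xs'\<close> it yields an
  isomorphism that fixes the boundary pointwise.\<close>

lemma describes_unique_iso:
  assumes "describes E t xs U" "describes E t xs' U'"
  shows "\<exists>f. graph_iso E f U U' \<and> map f xs = xs'"
  using assms
proof (induction t arbitrary: xs U xs' U')
  case (Leaf s)
  then show ?case by (auto elim: graph_iso_lists[of xs xs' E])
next
  case (Shift s t ys U ys' U')
  from Shift.prems(1) obtain xs W where 1: "distinct ys" "describes E t xs W" "U = W \<union> set ys"
    "W \<inter> set ys \<subseteq> set xs" "no_cross_edges E W (set ys)"
    "s = (length ys, adjacency_pattern E ys, coincidences xs ys)" by auto
  from Shift.prems(2) obtain xs' W' where 2: "distinct ys'" "describes E t xs' W'" "U' = W' \<union> set ys'"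
    "W' \<inter> set ys' \<subseteq> set xs'" "no_cross_edges E W' (set ys')"
    "s = (length ys', adjacency_pattern E ys', coincidences xs' ys')" by auto
  obtain g where g: "graph_iso E g W W'" "map g xs = xs'"
    using Shift.IH[OF 1(2) 2(2)] by blast
  obtain h where h: "graph_iso E h (set ys) (set ys')" "map h ys = ys'"
    using graph_iso_lists[of ys ys' E] 1 2 by auto
  \<comment> \<open>The common label says which old boundary positions reappear in the new boundary.
    This gives both the agreement of \<open>g\<close> and \<open>h\<close> on the overlap and the
    condition that the images overlap nowhere else.\<close>
  have coin: "coincidences xs ys = coincidences xs' ys'" using 1 2 by simp
  have len: "length xs = length xs'" "length ys = length ys'"
    using g(2) h(2) by auto
  have xg: "xs' ! i = g (xs ! i)" if "i < length xs" for i using that g(2) by (metis nth_map)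
  have yh: "ys' ! i = h (ys ! i)" if "i < length ys" for i using that h(2) by (metis nth_map)
  obtain f where f: "graph_iso E f (W \<union> set ys) (W' \<union> set ys')"
    "\<And>v. v \<in> W \<Longrightarrow> f v = g v" "\<And>v. v \<in> set ys \<Longrightarrow> f v = h v"
  proof (rule graph_iso_glue[OF g(1) h(1) _ _ 1(5) 2(5)])
    fix v assume v: "v \<in> W" "v \<in> set ys"
    then have "v \<in> set xs" using 1(4) by blast
    with v obtain i j where ij: "i < length xs" "xs ! i = v" "j < length ys" "ys ! j = v"
      unfolding in_set_conv_nth by blast
    then have "(i, j) \<in> coincidences xs' ys'" unfolding coin[symmetric] by (simp add: coincidences_def)
    then show "g v = h v" using ij xg yh by (auto simp: coincidences_def)
  next
    show "W' \<inter> set ys' \<subseteq> g ` (W \<inter> set ys)"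
    proof
      fix u assume u: "u \<in> W' \<inter> set ys'"
      then have "u \<in> set xs'" using 2(4) by blast
      with u obtain i j where ij: "i < length xs'" "xs' ! i = u" "j < length ys'" "ys' ! j = u"
        unfolding Int_iff in_set_conv_nth by blast
      then have "(i, j) \<in> coincidences xs ys" unfolding coin by (simp add: coincidences_def)
      then have "i < length xs" "j < length ys" "xs ! i = ys ! j" by (auto simp: coincidences_def)
      moreover from this have "xs ! i \<in> W" using describes_boundary_subset[OF 1(2)] nth_mem by blast
      moreover have "u = g (xs ! i)" using xg ij len by simp
      ultimately show "u \<in> g ` (W \<inter> set ys)" by auto
    qed
  qed blast
  have "map f ys = ys'" using h(2) f(3) by (metis map_cong)
  then show ?case using f(1) 1 2 by blast
next
  case (Join t\<^sub>1 t\<^sub>2 ys U ys' U')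
  from Join.prems(1) obtain A B where 1: "describes E t\<^sub>1 ys A" "describes E t\<^sub>2 ys B" "U = A \<union> B"
    "A \<inter> B = set ys" "no_cross_edges E A B" by auto
  from Join.prems(2) obtain A' B' where 2: "describes E t\<^sub>1 ys' A'" "describes E t\<^sub>2 ys' B'"
    "U' = A' \<union> B'" "A' \<inter> B' = set ys'" "no_cross_edges E A' B'" by auto
  obtain g where g: "graph_iso E g A A'" "map g ys = ys'" using Join.IH(1)[OF 1(1) 2(1)] by blast
  obtain h where h: "graph_iso E h B B'" "map h ys = ys'" using Join.IH(2)[OF 1(2) 2(2)] by blast
  obtain f where f: "graph_iso E f (A \<union> B) (A' \<union> B')" "\<And>v. v \<in> A \<Longrightarrow> f v = g v"
  proof (rule graph_iso_glue[OF g(1) h(1) _ _ 1(5) 2(5)])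
    fix v assume "v \<in> A" "v \<in> B"
    then have "v \<in> set ys" using 1 by blast
    then show "g v = h v" using g(2) h(2) by (metis map_eq_conv)
  next
    show "A' \<inter> B' \<subseteq> g ` (A \<inter> B)" unfolding 1 2 using g(2) by (metis order_refl set_map)
  qed blast
  have "map f ys = ys'" using g(2) f(2) 1(4) by (metis IntD1 map_cong)
  then show ?case using f(1) 1 2 by blast
qed

section \<open>Counting codes of bounded length\<close>

text \<open>Polish notation: \<open>Inl\<close> marks a leaf, \<open>Inr\<close> a shift and
  \<open>None\<close> a join, so that terms can be counted as words.\<close>

fun prefix_notation :: "'s code \<Rightarrow> ('s + 's) option list" where
  "prefix_notation (Leaf s) = [Some (Inl s)]"
| "prefix_notation (Shift s t) = Some (Inr s) # prefix_notation t"
| "prefix_notation (Join t\<^sub>1 t\<^sub>2) = None # prefix_notation t\<^sub>1 @ prefix_notation t\<^sub>2"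

text \<open>The trailing words serve the induction: in the \<open>Join\<close> case the notation of
  the second subterm trails that of the first.\<close>

lemma prefix_notation_unique:
  "prefix_notation t @ r = prefix_notation t' @ r' \<Longrightarrow> t = t' \<and> r = r'"
proof (induction t arbitrary: t' r r')
  case (Leaf s) then show ?case by (cases t') auto
next
  case (Shift s t) then show ?case by (cases t') auto
next
  case (Join t\<^sub>1 t\<^sub>2)
  from Join.prems obtain u\<^sub>1 u\<^sub>2 where "t' = Join u\<^sub>1 u\<^sub>2" by (cases t') auto
  then have "prefix_notation t\<^sub>1 @ (prefix_notation t\<^sub>2 @ r) = prefix_notation u\<^sub>1 @ (prefix_notation u\<^sub>2 @ r')"
    using Join.prems by simp
  from Join.IH(1)[OF this] have "t\<^sub>1 = u\<^sub>1" "prefix_notation t\<^sub>2 @ r = prefix_notation u\<^sub>2 @ r'" by auto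
  with Join.IH(2)[OF this(2)] show ?case using \<open>t' = _\<close> by simp
qed

abbreviation code_length :: "'s code \<Rightarrow> nat" where
  "code_length t \<equiv> length (prefix_notation t)"

definition codes_upto :: "'s set \<Rightarrow> nat \<Rightarrow> 's code set" where
  "codes_upto A m = {t. set_code t \<subseteq> A \<and> code_length t \<le> m}"

lemma sum_power_le: "(\<Sum>i\<le>m. (b :: nat) ^ i) \<le> (b + 1) ^ m"
proof (induction m)
  case (Suc m)
  have "(\<Sum>i\<le>Suc m. b ^ i) \<le> (b + 1) ^ m + b ^ Suc m" using Suc by simp
  also have "b ^ Suc m \<le> b * (b + 1) ^ m" by (simp add: power_mono mult_le_mono2)
  finally show ?case by simp
qed simp

lemma card_lists_le:
  assumes "finite A"
  shows "card {xs. set xs \<subseteq> A \<and> length xs \<le> m} \<le> (card A + 1) ^ m"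
  using card_lists_length_le[OF assms, of m] sum_power_le[of "card A" m] by simp

text \<open>Prefix notation embeds the terms into words over \<open>2 * card A + 1\<close> symbols;
  one more in the base accounts for the words shorter than \<open>m\<close>.\<close>

lemma codes_upto_finite_card:
  assumes "finite A"
  shows "finite (codes_upto A m)" "card (codes_upto A m) \<le> (2 * card A + 2) ^ m"
proof -
  define T where "T = insert None (Some ` (A <+> A))"
  have T: "finite T" using assms by (simp add: T_def)
  have "card T = 2 * card A + 1"
    using assms by (subst T_def, subst card_insert_disjoint) (auto simp: card_image card_Plus)
  have "set (prefix_notation t) \<subseteq> T" if "set_code t \<subseteq> A" for t
    using that by (induction t) (auto simp: T_def)
  then have sub: "prefix_notation ` codes_upto A m \<subseteq> {xs. set xs \<subseteq> T \<and> length xs \<le> m}"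
    by (auto simp: codes_upto_def)
  have inj: "inj_on prefix_notation (codes_upto A m)"
    by (rule inj_onI) (use prefix_notation_unique[of _ "[]" _ "[]"] in simp)
  show "finite (codes_upto A m)"
    by (rule finite_imageD[OF finite_subset[OF sub finite_lists_length_le[OF T]] inj])
  have "card (codes_upto A m) \<le> card {xs. set xs \<subseteq> T \<and> length xs \<le> m}"
    using card_image[OF inj] card_mono[OF finite_lists_length_le[OF T] sub] by simp
  also have "\<dots> \<le> (card T + 1) ^ m" using T by (rule card_lists_le)
  finally show "card (codes_upto A m) \<le> (2 * card A + 2) ^ m" using \<open>card T = _\<close> by simp
qed

subsection \<open>Leaves of trees\<close>

definition is_path :: "'i set set \<Rightarrow> 'i list \<Rightarrow> bool" where
  "is_path F xs \<longleftrightarrow> distinct xs \<and> (\<forall>i. Suc i < length xs \<longrightarrow> {xs ! i, xs ! Suc i} \<in> F)"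

text \<open>The first vertex \<open>l\<close> of a longest path is a leaf: a neighbour off the path
  would extend it, and a neighbour on the path other than the second vertex would close a
  cycle.\<close>

lemma tree_has_leaf:
  assumes tree: "is_tree I F" and two: "2 \<le> card I"
  obtains l p where "l \<in> I" "p \<in> I" "l \<noteq> p" "\<And>q. {l, q} \<in> F \<Longrightarrow> q = p"
proof -
  have fin: "finite I" and sub: "\<And>e. e \<in> F \<Longrightarrow> e \<subseteq> I \<and> card e = 2"
    and con: "induces_connected F I" and acyc: "\<And>xs. \<not> is_cycle F xs"
    using tree by (auto simp: is_tree_def simple_graph_def)
  define P where "P xs \<longleftrightarrow> is_path F xs \<and> set xs \<subseteq> I \<and> xs \<noteq> []" for xs
  obtain a b where ab: "a \<in> I" "b \<in> I" "a \<noteq> b"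
    using two fin by (metis One_nat_def Suc_1 card_le_Suc0_iff_eq not_less_eq_eq)
  have "P [a]" using ab by (simp add: P_def is_path_def)
  moreover have "length xs \<le> card I" if "P xs" for xs
    using that fin unfolding P_def is_path_def by (metis card_mono distinct_card)
  ultimately have "\<exists>xs. P xs \<and> (\<forall>ys. P ys \<longrightarrow> length ys \<le> length xs)"
    by (intro ex_has_greatest_nat[of P "[a]" length "Suc (card I)"]) (auto simp: less_Suc_eq_le)
  then obtain xs where xs: "P xs" and max: "\<And>ys. P ys \<Longrightarrow> length ys \<le> length xs" by blast
  then obtain l zs where l: "xs = l # zs" unfolding P_def by (cases xs) auto
  have lI: "l \<in> I" using xs l by (simp add: P_def)
  have nb: "q \<in> set xs \<and> q \<noteq> l" if "{l, q} \<in> F" for q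
  proof -
    have q: "q \<in> I" "q \<noteq> l" using sub[OF that] by auto
    have "q \<in> set xs"
    proof (rule ccontr)
      assume "q \<notin> set xs"
      then have "P (q # xs)"
        using xs q that l
        by (auto simp: P_def is_path_def nth_Cons insert_commute split: nat.splits)
      then show False using max[of "q # xs"] by simp
    qed
    then show ?thesis using q by simp
  qed
  have nb1: "q = xs ! 1" if lq: "{l, q} \<in> F" for q
  proof (rule ccontr)
    assume "q \<noteq> xs ! 1"
    obtain j where j: "j < length xs" "xs ! j = q" using nb[OF lq] unfolding in_set_conv_nth by blast
    have "j \<noteq> 0" using j nb[OF lq] l by (metis nth_Cons_0)
    moreover have "j \<noteq> 1" using j \<open>q \<noteq> _\<close> by blast
    ultimately have "2 \<le> j" by simp
    \<comment> \<open>The initial segment of the path up to \<open>q\<close>, closed by the edge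
      from \<open>q\<close> back to \<open>l\<close>; it has at least three vertices since
      \<open>2 \<le> j\<close>.\<close>
    define c where "c = take (Suc j) xs"
    have "length c = Suc j" using j by (simp add: c_def)
    moreover have "distinct c" using xs by (simp add: c_def P_def is_path_def)
    moreover have "{c ! i, c ! (Suc i mod length c)} \<in> F" if "i < length c" for i
    proof (cases "i = j")
      case True
      have "c ! j = q" using j by (simp add: c_def)
      moreover have "c ! 0 = l" by (simp add: c_def l)
      ultimately show ?thesis using True \<open>length c = _\<close> lq by (simp add: insert_commute)
    next
      case False
      then have "i < j" using that \<open>length c = _\<close> by simp
      then show ?thesis using \<open>length c = _\<close> j xs by (simp add: c_def P_def is_path_def)
    qed
    ultimately have "is_cycle F c" using \<open>2 \<le> j\<close> by (simp add: is_cycle_def)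
    then show False using acyc by blast
  qed
  obtain m where m: "m \<in> I" "m \<noteq> l" using ab by (cases "a = l") auto
  have "(l, m) \<in> {(x, y). x \<in> I \<and> y \<in> I \<and> {x, y} \<in> F}\<^sup>*"
    using con lI m by (simp add: induces_connected_def)
  then obtain p where p: "p \<in> I" "{l, p} \<in> F" using m(2) by (auto elim: converse_rtranclE)
  show thesis
  proof (rule that[OF lI p(1)])
    show "l \<noteq> p" using nb[OF p(2)] by blast
    show "q = p" if "{l, q} \<in> F" for q using nb1[OF that] nb1[OF p(2)] by simp
  qed
qed

lemma induces_connected_remove_leaf:
  assumes con: "induces_connected F S" and leaf: "\<And>q. {l, q} \<in> F \<Longrightarrow> q = p" and "l \<noteq> p"
  shows "induces_connected F (S - {l})"
  unfolding induces_connected_def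
proof (intro ballI)
  fix u v assume u: "u \<in> S - {l}" and v: "v \<in> S - {l}"
  let ?R = "{(x, y). x \<in> S - {l} \<and> y \<in> S - {l} \<and> {x, y} \<in> F}"
  have "(u, v) \<in> {(x, y). x \<in> S \<and> y \<in> S \<and> {x, y} \<in> F}\<^sup>*"
    using con u v by (simp add: induces_connected_def)
  \<comment> \<open>A walk can enter and leave \<open>l\<close> only through \<open>p\<close>, so
    visits to \<open>l\<close> can be cut out: while the walk stands at \<open>l\<close>, the
    invariant waits at \<open>p\<close>.\<close>
  then have "(u, if v = l then p else v) \<in> ?R\<^sup>*"
  proof (induction rule: rtrancl_induct)
    case base
    then show ?case using u by simp
  next
    case (step y z)
    have "y = p" if "z = l" using step(2) that leaf[of y] by (auto simp: insert_commute)
    moreover have "z = p" if "y = l" using step(2) that leaf[of z] by auto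
    ultimately show ?case using step \<open>l \<noteq> p\<close>
      by (auto intro: rtrancl_into_rtrancl split: if_splits)
  qed
  then show "(u, v) \<in> ?R\<^sup>*" using v by simp
qed

text \<open>A walk from \<open>l\<close> to another node inside the subtree of \<open>v\<close> must
  take \<open>p\<close> as its first step.\<close>

lemma leaf_running_intersection:
  assumes con: "induces_connected F {i \<in> I. v \<in> B i}" and leaf: "\<And>q. {l, q} \<in> F \<Longrightarrow> q = p"
    and "l \<in> I" "v \<in> B l" "j \<in> I" "v \<in> B j" "j \<noteq> l"
  shows "v \<in> B p"
proof -
  let ?S = "{i \<in> I. v \<in> B i}"
  have "(l, j) \<in> {(x, y). x \<in> ?S \<and> y \<in> ?S \<and> {x, y} \<in> F}\<^sup>*"
    using assms unfolding induces_connected_def by blast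
  then obtain q where "q \<in> ?S" "{l, q} \<in> F" using \<open>j \<noteq> l\<close> by (auto elim: converse_rtranclE)
  then show ?thesis using leaf by auto
qed

lemma is_tree_remove_leaf:
  assumes tree: "is_tree I F" and l: "l \<in> I" "p \<in> I" "l \<noteq> p" and leaf: "\<And>q. {l, q} \<in> F \<Longrightarrow> q = p"
  shows "is_tree (I - {l}) {e \<in> F. l \<notin> e}"
proof -
  have con: "induces_connected F (I - {l})"
    by (rule induces_connected_remove_leaf[OF _ leaf l(3)]) (use tree in \<open>simp_all add: is_tree_def\<close>)
  have "{(x, y). x \<in> I - {l} \<and> y \<in> I - {l} \<and> {x, y} \<in> {e \<in> F. l \<notin> e}} =
        {(x, y). x \<in> I - {l} \<and> y \<in> I - {l} \<and> {x, y} \<in> F}" by auto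
  with con have "induces_connected {e \<in> F. l \<notin> e} (I - {l})" by (simp only: induces_connected_def)
  moreover have "is_cycle F xs" if "is_cycle {e \<in> F. l \<notin> e} xs" for xs
    using that by (auto simp: is_cycle_def)
  moreover have "simple_graph (I - {l}) {e \<in> F. l \<notin> e}" "I - {l} \<noteq> {}"
    using tree l by (auto simp: is_tree_def simple_graph_def)
  ultimately show ?thesis using tree unfolding is_tree_def by blast
qed

subsection \<open>Short codes from tree decompositions\<close>

text \<open>The set depends on \<open>K\<close> alone, so the alphabet of the codes stays fixed
  while the graph grows.\<close>

definition boundary_labels :: "nat \<Rightarrow> label set" where
  "boundary_labels K = {..K} \<times> Pow ({..<K} \<times> {..<K}) \<times> Pow ({..<K} \<times> {..<K})"

lemma finite_boundary_labels: "finite (boundary_labels K)"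
  by (simp add: boundary_labels_def)

text \<open>
  The term \<open>card S - (K + 1)\<close> is a potential that makes the length bound survive the tree induction:
  a \<open>Shift\<close> either forgets a vertex or enlarges the boundary, and a \<open>Join\<close> of two proper
  parts gains a second summand \<open>K + 1\<close>.
\<close>

definition codable :: "'a set set \<Rightarrow> nat \<Rightarrow> 'a set \<Rightarrow> 'a set \<Rightarrow> bool" where
  "codable E K S U \<longleftrightarrow> finite U \<and> S \<subseteq> U \<and> card S \<le> K \<and>
     (\<forall>xs. distinct xs \<longrightarrow> set xs = S \<longrightarrow>
       (\<exists>t. describes E t xs U \<and> set_code t \<subseteq> boundary_labels K \<and>
          (if U = S then code_length t = 1
           else code_length t + (K + 1) \<le> (K + 3) * card (U - S) + card S)))"

lemma codableE:
  assumes "codable E K S U" "distinct xs" "set xs = S"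
  obtains t where "describes E t xs U" "set_code t \<subseteq> boundary_labels K"
    "if U = S then code_length t = 1
     else code_length t + (K + 1) \<le> (K + 3) * card (U - S) + card S"
  using assms unfolding codable_def by blast

lemma label_in_boundary_labels:
  assumes "length xs \<le> K" "length ys \<le> K"
  shows "(length ys, adjacency_pattern E ys, coincidences xs ys) \<in> boundary_labels K"
    "(length ys, adjacency_pattern E ys, {}) \<in> boundary_labels K"
  using assms by (auto simp: boundary_labels_def adjacency_pattern_def coincidences_def)

lemma codable_self:
  assumes "finite S" "card S \<le> K"
  shows "codable E K S S"
  unfolding codable_def
proof (intro conjI allI impI)
  fix xs assume xs: "distinct xs" "set xs = S"
  then have "length xs \<le> K" using assms by (metis distinct_card)
  then show "\<exists>t. describes E t xs S \<and> set_code t \<subseteq> boundary_labels K \<and>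
      (if S = S then code_length t = 1
       else code_length t + (K + 1) \<le> (K + 3) * card (S - S) + card S)"
    using xs label_in_boundary_labels(2)[of xs K xs E]
    by (intro exI[of _ "Leaf (length xs, adjacency_pattern E xs, {})"]) simp
qed (use assms in auto)

text \<open>If \<open>S\<close> is properly contained in \<open>S'\<close>, the growth of the
  boundary pays for the new symbol. Otherwise some vertex of \<open>S\<close> is forgotten and the
  main term gains at least \<open>K + 3\<close>. The cases \<open>U \<subseteq> S'\<close> and
  \<open>S = S'\<close> require no shift.\<close>

lemma codable_shift:
  assumes U: "codable E K S U" and S': "finite S'" "card S' \<le> K" and meet: "U \<inter> S' \<subseteq> S"
    and sep: "no_cross_edges E U S'"
  shows "codable E K S' (U \<union> S')"
proof (cases "U \<subseteq> S'")
  case True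
  then show ?thesis using codable_self[OF S'] by (simp add: Un_absorb1)
next
  case False
  have fin: "finite U" "S \<subseteq> U" "card S \<le> K" using U by (auto simp: codable_def)
  then have finS: "finite S" using finite_subset by blast
  obtain zs where zs: "distinct zs" "set zs = S" using finite_distinct_list[OF finS] by blast
  show ?thesis
  proof (cases "S = S'")
    case True
    then show ?thesis using U fin by (simp add: Un_absorb2)
  next
    case ne: False
    obtain t where t: "describes E t zs U" "set_code t \<subseteq> boundary_labels K"
      "if U = S then code_length t = 1
       else code_length t + (K + 1) \<le> (K + 3) * card (U - S) + card S"
      by (rule codableE[OF U zs])
    have lz: "length zs \<le> K" using zs fin by (metis distinct_card)
    \<comment> \<open>The vertices newly counted as interior are exactly those of the old boundary
      that are dropped; \<open>meet\<close> keeps the old interior out of \<open>S'\<close>.\<close>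
    have "U - S' = (U - S) \<union> (S - S')" using meet fin by blast
    moreover have "(U - S) \<inter> (S - S') = {}" by blast
    ultimately have cU: "card (U - S') = card (U - S) + card (S - S')"
      using fin finS by (simp add: card_Un_disjoint)
    have bound: "code_length t + 1 + (K + 1) \<le> (K + 3) * card (U - S') + card S'"
    proof (cases "S \<subseteq> S'")
      case True
      then have "card S < card S'" using ne S' by (metis psubset_card_mono psubsetI)
      moreover have "U \<noteq> S" using True False by blast
      moreover have "card (S - S') = 0" using True by (simp add: Diff_eq_empty_iff[THEN iffD2])
      ultimately show ?thesis using t(3) cU by simp
    next
      case nsub: False
      then have pos: "card (S - S') \<ge> 1" using finS
        by (metis Diff_eq_empty_iff One_nat_def Suc_leI card_gt_0_iff finite_Diff)
      \<comment> \<open>The coefficient comes from the case \<open>U = S\<close>: one symbol for the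
        leaf, one for the shift, and the \<open>K + 1\<close> of the potential.\<close>
      have "(K + 3) * 1 \<le> (K + 3) * card (S - S')" using pos by (rule mult_le_mono2)
      then have *: "(K + 3) * card (U - S) + (K + 3) \<le> (K + 3) * card (U - S')"
        unfolding cU by (simp add: algebra_simps)
      show ?thesis
      proof (cases "U = S")
        case True
        then have "code_length t = 1" using t(3) by simp
        then show ?thesis using * by linarith
      next
        case False
        then have "code_length t + (K + 1) \<le> (K + 3) * card (U - S) + card S" using t(3) by simp
        then show ?thesis using * fin(3) by linarith
      qed
    qed
    have eq: "(U \<union> S') - S' = U - S'" by blast
    show ?thesis unfolding codable_def
    proof (intro conjI allI impI)
      fix ys assume ys: "distinct ys" "set ys = S'"
      then have ly: "length ys \<le> K" using S' by (metis distinct_card)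
      let ?s = "(length ys, adjacency_pattern E ys, coincidences zs ys)"
      have "describes E (Shift ?s t) ys (U \<union> S')"
        using ys t(1) meet sep zs by auto
      moreover have "set_code (Shift ?s t) \<subseteq> boundary_labels K"
        using t(2) label_in_boundary_labels(1)[OF lz ly] by simp
      moreover have "U \<union> S' \<noteq> S'" using False by blast
      ultimately show "\<exists>t. describes E t ys (U \<union> S') \<and> set_code t \<subseteq> boundary_labels K \<and>
         (if U \<union> S' = S' then code_length t = 1
          else code_length t + (K + 1) \<le> (K + 3) * card (U \<union> S' - S') + card S')"
        using bound eq by (intro exI[of _ "Shift ?s t"]) simp
    qed (use fin S' in auto)
  qed
qed

text \<open>Adding the two bounds leaves a surplus \<open>K + 1\<close>, which pays for the symbol
  \<open>None\<close> and for the second copy of \<open>card S\<close>, at most \<open>K\<close>. If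
  one part is only the boundary, the union is the other part.\<close>

lemma codable_join:
  assumes U1: "codable E K S U\<^sub>1" and U2: "codable E K S U\<^sub>2" and meet: "U\<^sub>1 \<inter> U\<^sub>2 = S"
    and sep: "no_cross_edges E U\<^sub>1 U\<^sub>2"
  shows "codable E K S (U\<^sub>1 \<union> U\<^sub>2)"
proof (cases "U\<^sub>1 = S \<or> U\<^sub>2 = S")
  case True
  moreover have "S \<subseteq> U\<^sub>1" "S \<subseteq> U\<^sub>2" using meet by auto
  ultimately show ?thesis using U1 U2 by (auto simp: Un_absorb1 Un_absorb2)
next
  case False
  have fin: "finite U\<^sub>1" "finite U\<^sub>2" "S \<subseteq> U\<^sub>1" "S \<subseteq> U\<^sub>2" "card S \<le> K"
    using U1 U2 by (auto simp: codable_def)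
  have "U\<^sub>1 \<union> U\<^sub>2 - S = (U\<^sub>1 - S) \<union> (U\<^sub>2 - S)" by blast
  moreover have "(U\<^sub>1 - S) \<inter> (U\<^sub>2 - S) = {}" using meet by blast
  ultimately have c: "card (U\<^sub>1 \<union> U\<^sub>2 - S) = card (U\<^sub>1 - S) + card (U\<^sub>2 - S)"
    using fin by (simp add: card_Un_disjoint)
  show ?thesis unfolding codable_def
  proof (intro conjI allI impI)
    fix xs assume xs: "distinct xs" "set xs = S"
    have ne: "U\<^sub>1 \<noteq> S" "U\<^sub>2 \<noteq> S" using False by auto
    obtain t\<^sub>1 where t1: "describes E t\<^sub>1 xs U\<^sub>1" "set_code t\<^sub>1 \<subseteq> boundary_labels K"
      "code_length t\<^sub>1 + (K + 1) \<le> (K + 3) * card (U\<^sub>1 - S) + card S"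
      by (rule codableE[OF U1 xs]) (simp add: ne)
    obtain t\<^sub>2 where t2: "describes E t\<^sub>2 xs U\<^sub>2" "set_code t\<^sub>2 \<subseteq> boundary_labels K"
      "code_length t\<^sub>2 + (K + 1) \<le> (K + 3) * card (U\<^sub>2 - S) + card S"
      by (rule codableE[OF U2 xs]) (simp add: ne)
    have "describes E (Join t\<^sub>1 t\<^sub>2) xs (U\<^sub>1 \<union> U\<^sub>2)"
      using t1(1) t2(1) meet sep xs by auto
    moreover have "code_length (Join t\<^sub>1 t\<^sub>2) + (K + 1) \<le> (K + 3) * card (U\<^sub>1 \<union> U\<^sub>2 - S) + card S"
      using t1(3) t2(3) fin(5) unfolding c by (simp add: algebra_simps)
    moreover have "U\<^sub>1 \<union> U\<^sub>2 \<noteq> S" using False fin by blast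
    ultimately show "\<exists>t. describes E t xs (U\<^sub>1 \<union> U\<^sub>2) \<and> set_code t \<subseteq> boundary_labels K \<and>
        (if U\<^sub>1 \<union> U\<^sub>2 = S then code_length t = 1
         else code_length t + (K + 1) \<le> (K + 3) * card (U\<^sub>1 \<union> U\<^sub>2 - S) + card S)"
      using t1(2) t2(2) by (intro exI[of _ "Join t\<^sub>1 t\<^sub>2"]) simp
  qed (use fin in auto)
qed

text \<open>
  Induction on the tree: the part \<open>U l\<close> already assembled at a leaf \<open>l\<close> is merged into the
  part of its neighbour.
\<close>

lemma codable_tree:
  assumes "is_tree I F"
    and "\<And>v. induces_connected F {i \<in> I. v \<in> B i}"
    and "\<And>i. i \<in> I \<Longrightarrow> codable E K (B i) (U i)"
    and "\<And>i j. i \<in> I \<Longrightarrow> j \<in> I \<Longrightarrow> i \<noteq> j \<Longrightarrow> U i \<inter> U j \<subseteq> B i \<inter> B j"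
    and "\<And>u w. {u, w} \<in> E \<Longrightarrow> u \<in> (\<Union>i\<in>I. U i) \<Longrightarrow> w \<in> (\<Union>i\<in>I. U i) \<Longrightarrow> \<exists>i\<in>I. u \<in> U i \<and> w \<in> U i"
  shows "\<exists>r\<in>I. codable E K (B r) (\<Union>i\<in>I. U i)"
  using assms
proof (induction "card I" arbitrary: I F U rule: less_induct)
  case less
  note tree = less.prems(1) and con = less.prems(2) and cod = less.prems(3)
    and meet = less.prems(4) and edge = less.prems(5)
  have fin: "finite I" and "I \<noteq> {}" using tree by (auto simp: is_tree_def simple_graph_def)
  show ?case
  proof (cases "card I \<ge> 2")
    case False
    then have "card I = 1" using fin \<open>I \<noteq> {}\<close> by (metis One_nat_def Suc_1 card_0_eq less_2_cases not_le)
    then obtain r where "I = {r}" by (rule card_1_singletonE)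
    then show ?thesis using cod by simp
  next
    case True
    obtain l p where l: "l \<in> I" "p \<in> I" "l \<noteq> p" and leaf: "\<And>q. {l, q} \<in> F \<Longrightarrow> q = p"
      using tree_has_leaf[OF tree True] by blast
    \<comment> \<open>Everything that the part at \<open>l\<close> shares with any other part passes
      through the bag of \<open>p\<close>.\<close>
    have rip: "U l \<inter> U j \<subseteq> B p" if "j \<in> I" "j \<noteq> l" for j
      using meet[of l j] leaf_running_intersection[OF con leaf] that l by blast
    let ?I = "I - {l}" and ?F = "{e \<in> F. l \<notin> e}" and ?U = "U(p := U l \<union> U p)"
    have Bp: "finite (B p)" "card (B p) \<le> K" "B p \<subseteq> U p"
      using cod[OF l(2)] by (auto simp: codable_def intro: finite_subset)
    have Bl: "B l \<subseteq> U l" using cod[OF l(1)] by (simp add: codable_def)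
    \<comment> \<open>The edge lies in some part \<open>U j\<close>, and \<open>j \<noteq> l\<close>
      because \<open>w\<close> is not in \<open>U l\<close>; so \<open>u\<close> is shared and lies
      in \<open>B p\<close>.\<close>
    have cross: "u \<in> B p" if uw: "{u, w} \<in> E" "u \<in> U l" "w \<in> U p" "w \<notin> U l" for u w
    proof -
      obtain j where "j \<in> I" "u \<in> U j" "w \<in> U j" using edge[OF uw(1)] uw(2,3) l by blast
      then show ?thesis using rip[of j] uw by blast
    qed
    \<comment> \<open>First the boundary of the part at \<open>l\<close> moves from
      \<open>B l\<close> to \<open>B p\<close>, then this part is joined with \<open>U p\<close>
      along \<open>B p\<close>.\<close>
    have "codable E K (B p) (U l \<union> B p)"
    proof (rule codable_shift[OF cod[OF l(1)] Bp(1,2)])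
      show "U l \<inter> B p \<subseteq> B l" using meet[OF l] Bp(3) by blast
      show "no_cross_edges E (U l) (B p)" using cross Bp(3) unfolding no_cross_edges_def by blast
    qed
    then have "codable E K (B p) ((U l \<union> B p) \<union> U p)"
    proof (rule codable_join[OF _ cod[OF l(2)]])
      show "(U l \<union> B p) \<inter> U p = B p" using rip[OF l(2)] l(3) Bp(3) by blast
      show "no_cross_edges E (U l \<union> B p) (U p)" using cross Bp(3) unfolding no_cross_edges_def by blast
    qed
    moreover have "(U l \<union> B p) \<union> U p = U l \<union> U p" using Bp(3) by blast
    ultimately have codp: "codable E K (B p) (U l \<union> U p)" by simp
    have un: "(\<Union>i\<in>?I. ?U i) = (\<Union>i\<in>I. U i)"
    proof -
      have "I = insert l (insert p (I - {l, p}))" "?I = insert p (I - {l, p})" using l by auto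
      moreover have "(\<Union>i\<in>I - {l, p}. ?U i) = (\<Union>i\<in>I - {l, p}. U i)" by auto
      ultimately show ?thesis by (metis UN_insert Un_assoc fun_upd_same)
    qed
    have "\<exists>r\<in>?I. codable E K (B r) (\<Union>i\<in>?I. ?U i)"
    proof (rule less.hyps)
      show "card ?I < card I" using fin l by (meson card_Diff1_less)
      show "is_tree ?I ?F" by (rule is_tree_remove_leaf[OF tree l leaf])
      show "induces_connected ?F {i \<in> ?I. v \<in> B i}" for v
      proof -
        have "induces_connected F ({i \<in> I. v \<in> B i} - {l})"
          by (rule induces_connected_remove_leaf[OF con leaf l(3)])
        moreover have "{i \<in> I. v \<in> B i} - {l} = {i \<in> ?I. v \<in> B i}" by blast
        moreover have "{(x, y). x \<in> {i \<in> ?I. v \<in> B i} \<and> y \<in> {i \<in> ?I. v \<in> B i} \<and> {x, y} \<in> ?F} =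
          {(x, y). x \<in> {i \<in> ?I. v \<in> B i} \<and> y \<in> {i \<in> ?I. v \<in> B i} \<and> {x, y} \<in> F}" by auto
        ultimately show ?thesis by (simp only: induces_connected_def)
      qed
      show "codable E K (B i) (?U i)" if "i \<in> ?I" for i
        using that cod codp by auto
      show "?U i \<inter> ?U j \<subseteq> B i \<inter> B j" if "i \<in> ?I" "j \<in> ?I" "i \<noteq> j" for i j
      proof -
        have "(U l \<union> U p) \<inter> U j \<subseteq> B p \<inter> B j" if "j \<in> ?I" "j \<noteq> p" for j
          using rip[of j] meet[of l j] meet[of p j] that l by blast
        then show ?thesis using that meet[of i j] by (cases "i = p"; cases "j = p"; auto)
      qed
      show "\<exists>i\<in>?I. u \<in> ?U i \<and> w \<in> ?U i"
        if uw: "{u, w} \<in> E" "u \<in> (\<Union>i\<in>?I. ?U i)" "w \<in> (\<Union>i\<in>?I. ?U i)" for u w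
      proof -
        obtain i where i: "i \<in> I" "u \<in> U i" "w \<in> U i" using edge uw unfolding un by blast
        show ?thesis
        proof (cases "i = l \<or> i = p")
          case True then show ?thesis using i l by (intro bexI[of _ p]) auto
        next
          case False then show ?thesis using i by (intro bexI[of _ i]) auto
        qed
      qed
    qed
    then show ?thesis unfolding un by blast
  qed
qed

text \<open>Bags of a decomposition of width at most \<open>k\<close> are restricted to
  \<open>U\<close> and enlarged by \<open>X\<close>, giving at most \<open>2 * k + 2\<close>
  vertices each. The parts start as the bags themselves, and the tree induction assembles
  them.\<close>

lemma code_exists:
  assumes G: "simple_graph V E" and tw: "treewidth V E \<le> int k"
    and XU: "X \<subseteq> U" "U \<subseteq> V" and X: "card X \<le> k + 1" and xs: "distinct xs" "set xs = X"
  shows "\<exists>t. describes E t xs U \<and>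
    t \<in> codes_upto (boundary_labels (2 * k + 2)) ((2 * k + 5) * card (U - X) + 1)"
proof -
  let ?K = "2 * k + 2"
  obtain I :: "nat set" and F B where td: "tree_decomposition V E I F B"
    and w: "decomposition_width I B \<le> int k"
    using treewidth_attained(1)[OF G] tw by auto
  have tree: "is_tree I F" and BV: "\<And>i. i \<in> I \<Longrightarrow> B i \<subseteq> V"
    and cov: "\<And>v. v \<in> V \<Longrightarrow> \<exists>i\<in>I. v \<in> B i" and ecov: "\<And>e. e \<in> E \<Longrightarrow> \<exists>i\<in>I. e \<subseteq> B i"
    and con: "\<And>v. v \<in> V \<Longrightarrow> induces_connected F {i \<in> I. v \<in> B i}"
    using td by (auto simp: tree_decomposition_def)
  have finI: "finite I" "I \<noteq> {}" and conI: "induces_connected F I"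
    using tree by (auto simp: is_tree_def simple_graph_def)
  have finV: "finite V" using G by (simp add: simple_graph_def)
  have finU: "finite U" "finite X" using XU finV by (auto intro: finite_subset)
  have cardB: "card (B i) \<le> k + 1" if "i \<in> I" for i
  proof -
    have "card (B i) \<le> Max ((\<lambda>i. card (B i)) ` I)" using that finI by simp
    then show ?thesis using w by (simp add: decomposition_width_def)
  qed
  define C where "C i = (B i \<inter> U) \<union> X" for i
  have un: "(\<Union>i\<in>I. C i) = U" using XU cov finI by (fastforce simp: C_def)
  have "\<exists>r\<in>I. codable E ?K (C r) (\<Union>i\<in>I. C i)"
  proof (rule codable_tree[OF tree])
    show "induces_connected F {i \<in> I. v \<in> C i}" for v
    proof (cases "v \<in> X")
      case True
      then have "{i \<in> I. v \<in> C i} = I" by (auto simp: C_def)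
      then show ?thesis using conI by simp
    next
      case nX: False
      show ?thesis
      proof (cases "v \<in> U")
        case True
        then have "{i \<in> I. v \<in> C i} = {i \<in> I. v \<in> B i}" using nX by (auto simp: C_def)
        then show ?thesis using con True XU by auto
      next
        case False
        then have "{i \<in> I. v \<in> C i} = {}" using nX by (auto simp: C_def)
        then show ?thesis by (simp only: induces_connected_def) simp
      qed
    qed
    show "codable E ?K (C i) (C i)" if "i \<in> I" for i
    proof (rule codable_self)
      show "finite (C i)" using finU by (simp add: C_def)
      have "card (C i) \<le> card (B i \<inter> U) + card X" unfolding C_def by (rule card_Un_le)
      also have "card (B i \<inter> U) \<le> card (B i)"
        using BV[OF that] finV by (intro card_mono) (auto intro: finite_subset)
      finally show "card (C i) \<le> ?K" using cardB[OF that] X by simp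
    qed
    show "\<exists>i\<in>I. u \<in> C i \<and> w \<in> C i"
      if uw: "{u, w} \<in> E" "u \<in> (\<Union>i\<in>I. C i)" "w \<in> (\<Union>i\<in>I. C i)" for u w
    proof -
      obtain i where "i \<in> I" "{u, w} \<subseteq> B i" using ecov uw(1) by blast
      then show ?thesis using uw(2,3) unfolding un C_def by blast
    qed
  qed simp
  then obtain r where r: "r \<in> I" "codable E ?K (C r) U" using un by auto
  \<comment> \<open>Every enlarged bag contains \<open>X\<close>, so one last shift makes
    \<open>X\<close> itself the boundary.\<close>
  have "codable E ?K X (U \<union> X)"
  proof (rule codable_shift[OF r(2) finU(2)])
    show "no_cross_edges E U X" using XU by (auto simp: no_cross_edges_def)
  qed (use X in \<open>auto simp: C_def\<close>)
  then have "codable E ?K X U" using XU by (simp add: Un_absorb2)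
  then obtain t where t: "describes E t xs U" "set_code t \<subseteq> boundary_labels ?K"
    "if U = X then code_length t = 1
     else code_length t + (?K + 1) \<le> (?K + 3) * card (U - X) + card X"
    by (rule codableE[OF _ xs])
  \<comment> \<open>The potential \<open>?K + 1\<close> exceeds \<open>card X\<close> and absorbs
    it; the summand \<open>1\<close> is for \<open>U = X\<close>, where the code is a single
    leaf.\<close>
  have "code_length t \<le> (2 * k + 5) * card (U - X) + 1"
  proof (cases "U = X")
    case False
    then have "code_length t + (?K + 1) \<le> (?K + 3) * card (U - X) + card X" using t(3) by simp
    moreover have "?K + 3 = 2 * k + 5" by simp
    ultimately have "code_length t + (?K + 1) \<le> (2 * k + 5) * card (U - X) + card X" by (simp only:)
    then show ?thesis using X by linarith
  qed (use t(3) in simp)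
  then show ?thesis using t(1,2) unfolding codes_upto_def by blast
qed

subsection \<open>Components\<close>

text \<open>The closure is reflexive, so a vertex outside \<open>S\<close> gets the singleton of
  itself; \<open>components\<close> therefore ranges over \<open>S\<close> only.\<close>

definition component :: "'a set set \<Rightarrow> 'a set \<Rightarrow> 'a \<Rightarrow> 'a set" where
  "component E S v = {(x, y). x \<in> S \<and> y \<in> S \<and> {x, y} \<in> E}\<^sup>* `` {v}"

definition components :: "'a set set \<Rightarrow> 'a set \<Rightarrow> 'a set set" where
  "components E S = component E S ` S"

lemma self_in_component: "v \<in> component E S v"
  by (simp add: component_def)

lemma component_subset: "v \<in> S \<Longrightarrow> component E S v \<subseteq> S"
  by (auto simp: component_def elim: rtranclE)

lemma component_eq:
  assumes "u \<in> component E S v"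
  shows "component E S u = component E S v"
proof -
  let ?R = "{(x, y). x \<in> S \<and> y \<in> S \<and> {x, y} \<in> E}"
  have "sym (?R\<^sup>*)" by (rule sym_rtrancl) (auto simp: sym_def insert_commute)
  moreover have "(v, u) \<in> ?R\<^sup>*" using assms by (simp add: component_def)
  ultimately have vu: "(v, u) \<in> ?R\<^sup>*" "(u, v) \<in> ?R\<^sup>*" by (auto dest: symD)
  have "(u, x) \<in> ?R\<^sup>* \<longleftrightarrow> (v, x) \<in> ?R\<^sup>*" for x
    using rtrancl_trans[OF vu(1), of x] rtrancl_trans[OF vu(2), of x] by blast
  then show ?thesis unfolding component_def by blast
qed

lemma component_edge:
  assumes "u \<in> S" "w \<in> S" "{u, w} \<in> E"
  shows "component E S u = component E S w"
  by (rule component_eq[symmetric]) (use assms in \<open>auto simp: component_def\<close>)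

lemma components_eq:
  assumes "C \<in> components E S" "v \<in> C"
  shows "component E S v = C" "v \<in> S"
  using assms component_eq component_subset unfolding components_def by fast+

lemma component_in_components: "v \<in> S \<Longrightarrow> component E S v \<in> components E S"
  by (simp add: components_def)

lemma card_components_ge:
  assumes "finite S"
  shows "card {C \<in> components E S. m \<le> card C} * m \<le> card S"
proof -
  let ?L = "{C \<in> components E S. m \<le> card C}"
  have fin: "finite ?L" using assms by (simp add: components_def)
  have CS: "C \<subseteq> S" if "C \<in> components E S" for C using components_eq(2)[OF that] by blast
  have "card ?L * m \<le> (\<Sum>C\<in>?L. card C)"
    using sum_mono[of ?L "\<lambda>_. m" card] by simp
  also have "\<dots> = card (\<Union>?L)"
  proof (rule card_Union_disjoint[symmetric])
    show "pairwise disjnt ?L"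
      unfolding pairwise_def disjnt_def using components_eq(1) by (metis (no_types, lifting) disjoint_iff mem_Collect_eq)
    show "\<And>C. C \<in> ?L \<Longrightarrow> finite C" using CS assms by (auto intro: finite_subset)
  qed
  also have "\<dots> \<le> card S" using CS assms by (intro card_mono) auto
  finally show ?thesis .
qed

text \<open>A walk that avoids \<open>X\<close> cannot leave \<open>W\<close>, since neighbours of
  \<open>W\<close> lie in \<open>W\<close> or \<open>X\<close>.\<close>

lemma good_pair_component_subset:
  assumes "(X, W) \<in> good_pairs k V E" "v \<in> W"
  shows "component E (V - X) v \<subseteq> W"
proof
  fix u assume "u \<in> component E (V - X) v"
  then have "(v, u) \<in> {(x, y). x \<in> V - X \<and> y \<in> V - X \<and> {x, y} \<in> E}\<^sup>*" by (simp add: component_def)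
  then show "u \<in> W"
  proof (induction rule: rtrancl_induct)
    case (step y z)
    then show ?case using assms(1) by (auto simp: good_pairs_def neighbours_def)
  qed (rule assms)
qed

text \<open>The isomorphisms of the single components all fix \<open>X\<close>, so they combine to
  one map. Distinct components have no edges between them, and \<open>\<beta>\<close> keeps distinct
  components distinct.\<close>

lemma good_pair_iso_by_components:
  assumes W: "(X, W) \<in> good_pairs k V E" and Z: "(X, Z) \<in> good_pairs k V E"
    and \<beta>: "bij_betw \<beta> {C \<in> components E (V - X). C \<subseteq> W} {C \<in> components E (V - X). C \<subseteq> Z}"
    and iso: "\<And>C. C \<in> components E (V - X) \<Longrightarrow> C \<subseteq> W \<Longrightarrow>
                \<exists>f. graph_iso E f (X \<union> C) (X \<union> \<beta> C) \<and> (\<forall>v\<in>X. f v = v)"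
  shows "((X, W), (X, Z)) \<in> good_pair_iso k V E"
proof -
  let ?S = "V - X"
  let ?c = "component E ?S"
  have WS: "W \<subseteq> ?S" "Z \<subseteq> ?S" using W Z by (auto simp: good_pairs_def)
  obtain \<phi> where \<phi>: "\<And>C. C \<in> components E ?S \<Longrightarrow> C \<subseteq> W \<Longrightarrow> graph_iso E (\<phi> C) (X \<union> C) (X \<union> \<beta> C)"
    and \<phi>X: "\<And>C v. C \<in> components E ?S \<Longrightarrow> C \<subseteq> W \<Longrightarrow> v \<in> X \<Longrightarrow> \<phi> C v = v"
    using iso by metis
  define F where "F v = (if v \<in> X then v else \<phi> (?c v) v)" for v
  have cW: "?c v \<in> components E ?S" "?c v \<subseteq> W" if "v \<in> W" for v
    using that WS component_in_components[of v ?S E] good_pair_component_subset[OF W that] by auto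
  have \<beta>C: "\<beta> C \<in> components E ?S" "\<beta> C \<subseteq> Z" if "C \<in> components E ?S" "C \<subseteq> W" for C
    using bij_betw_apply[OF \<beta>, of C] that by auto
  have CX: "C \<inter> X = {}" if "C \<in> components E ?S" for C using components_eq(2)[OF that] by blast
  have F\<phi>: "F v = \<phi> C v" if "C \<in> components E ?S" "C \<subseteq> W" "v \<in> X \<union> C" for C v
    using that \<phi>X components_eq(1)[of C E ?S v] by (auto simp: F_def)
  \<comment> \<open>Since \<open>\<phi> C\<close> is the identity on \<open>X\<close>, it must carry
    the rest, \<open>C\<close>, onto \<open>\<beta> C\<close>.\<close>
  have \<phi>img: "\<phi> C ` C = \<beta> C" and \<phi>inj: "inj_on (\<phi> C) (X \<union> C)"
    if C: "C \<in> components E ?S" "C \<subseteq> W" for C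
  proof -
    have b: "bij_betw (\<phi> C) (X \<union> C) (X \<union> \<beta> C)" using \<phi>[OF C] by (simp add: graph_iso_def)
    then show inj: "inj_on (\<phi> C) (X \<union> C)" by (simp add: bij_betw_def)
    have "\<phi> C ` X = X" using \<phi>X[OF C] by simp
    have "\<phi> C ` C = \<phi> C ` ((X \<union> C) - X)" using CX[OF C(1)] by (intro arg_cong[of _ _ "image (\<phi> C)"]) blast
    also have "\<dots> = \<phi> C ` (X \<union> C) - \<phi> C ` X" using inj by (intro inj_on_image_set_diff) auto
    also have "\<dots> = (X \<union> \<beta> C) - X" using b \<open>\<phi> C ` X = X\<close> by (simp add: bij_betw_def)
    also have "\<dots> = \<beta> C" using CX[OF \<beta>C(1)[OF C]] by blast
    finally show "\<phi> C ` C = \<beta> C" .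
  qed
  have Fin: "F v \<in> \<beta> (?c v)" if "v \<in> W" for v
    using F\<phi>[OF cW[OF that], of v] \<phi>img[OF cW[OF that]] self_in_component[of v E ?S] by auto
  have Fc: "?c (F v) = \<beta> (?c v)" "F v \<in> Z" "F v \<notin> X" if "v \<in> W" for v
    using components_eq(1)[OF \<beta>C(1)[OF cW[OF that]] Fin[OF that]] Fin[OF that]
      \<beta>C(2)[OF cW[OF that]] WS by auto
  have FX: "F v = v" if "v \<in> X" for v using that by (simp add: F_def)
  have c_inj: "?c v = ?c w" if "v \<in> W" "w \<in> W" "\<beta> (?c v) = \<beta> (?c w)" for v w
    using bij_betw_imp_inj_on[OF \<beta>] cW[OF that(1)] cW[OF that(2)] that(3) by (auto dest: inj_onD)
  \<comment> \<open>Unless they lie in different components, two vertices, at least one in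
    \<open>W\<close>, sit in one set \<open>X \<union> C\<close>, where a single
    \<open>\<phi> C\<close> decides both injectivity and adjacency.\<close>
  have same: "\<exists>C. C \<in> components E ?S \<and> C \<subseteq> W \<and> v \<in> X \<union> C \<and> w \<in> X \<union> C"
    if "v \<in> X \<union> W" "w \<in> X \<union> W" "v \<in> W \<or> w \<in> W" "v \<in> W \<Longrightarrow> w \<in> W \<Longrightarrow> ?c v = ?c w" for v w
  proof (cases "v \<in> W")
    case True
    then show ?thesis using that cW[OF True] self_in_component[of v E ?S] self_in_component[of w E ?S]
      by (intro exI[of _ "?c v"]) auto
  next
    case False
    then have "w \<in> W" using that by blast
    then show ?thesis using that False cW[of w] self_in_component[of w E ?S]
      by (intro exI[of _ "?c w"]) auto
  qed
  have "inj_on F (X \<union> W)"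
  proof (rule inj_onI)
    fix v w assume vw: "v \<in> X \<union> W" "w \<in> X \<union> W" and eq: "F v = F w"
    show "v = w"
    proof (cases "v \<in> W \<or> w \<in> W")
      case True
      have "?c v = ?c w" if "v \<in> W" "w \<in> W" using Fc(1)[OF that(1)] Fc(1)[OF that(2)] eq c_inj[OF that] by simp
      then obtain C where C: "C \<in> components E ?S" "C \<subseteq> W" "v \<in> X \<union> C" "w \<in> X \<union> C"
        using same[OF vw True] by blast
      then show ?thesis using F\<phi>[OF C(1,2)] eq \<phi>inj[OF C(1,2)] by (auto dest: inj_onD)
    next
      case False
      then show ?thesis using vw eq FX by auto
    qed
  qed
  moreover have "F ` (X \<union> W) = X \<union> Z"
  proof
    show "F ` (X \<union> W) \<subseteq> X \<union> Z" using FX Fc(2) by auto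
    show "X \<union> Z \<subseteq> F ` (X \<union> W)"
    proof
      fix z assume z: "z \<in> X \<union> Z"
      show "z \<in> F ` (X \<union> W)"
      proof (cases "z \<in> X")
        case True then show ?thesis using FX by (metis UnI1 image_eqI)
      next
        case False
        then have "z \<in> Z" using z by blast
        then have "?c z \<in> {C \<in> components E ?S. C \<subseteq> Z}"
          using WS component_in_components[of z ?S E] good_pair_component_subset[OF Z] by auto
        then have "?c z \<in> \<beta> ` {C \<in> components E ?S. C \<subseteq> W}" using bij_betw_imp_surj_on[OF \<beta>] by simp
        then obtain C where C: "C \<in> components E ?S" "C \<subseteq> W" "\<beta> C = ?c z" by blast
        have "z \<in> \<phi> C ` C" using \<phi>img[OF C(1,2)] C(3) self_in_component[of z E ?S] by simp
        then obtain v where "v \<in> C" "z = \<phi> C v" by blast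
        then have "F v = z" "v \<in> W" using F\<phi>[OF C(1,2), of v] C(2) by auto
        then show ?thesis by blast
      qed
    qed
  qed
  ultimately have bij: "bij_betw F (X \<union> W) (X \<union> Z)" by (simp add: bij_betw_def)
  have edges: "{v, w} \<in> E \<longleftrightarrow> {F v, F w} \<in> E" if vw: "v \<in> X \<union> W" "w \<in> X \<union> W" for v w
  proof (cases "v \<in> W \<and> w \<in> W \<and> ?c v \<noteq> ?c w")
    case True
    then have "{v, w} \<notin> E" using component_edge[of v ?S w E] WS by blast
    moreover have "?c (F v) \<noteq> ?c (F w)" using True Fc(1) c_inj by metis
    then have "{F v, F w} \<notin> E" using component_edge[of "F v" ?S "F w" E] WS Fc(2) True by blast
    ultimately show ?thesis by simp
  next
    case False
    show ?thesis
    proof (cases "v \<in> W \<or> w \<in> W")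
      case True
      then obtain C where C: "C \<in> components E ?S" "C \<subseteq> W" "v \<in> X \<union> C" "w \<in> X \<union> C"
        using same[OF vw True] False by blast
      then show ?thesis using F\<phi>[OF C(1,2)] \<phi>[OF C(1,2)] by (simp add: graph_iso_def)
    next
      case False
      then show ?thesis using vw FX by auto
    qed
  qed
  show ?thesis
    by (rule good_pair_isoI[OF W Z bij]) (use FX edges in auto)
qed

subsection \<open>Counting\<close>

text \<open>Fibres of \<open>l\<close> with equal size are matched one label at a time.\<close>

lemma bij_betw_preserving_labels:
  assumes "finite P" "finite Q"
    and card: "\<And>t. card {C \<in> P. l C = t} = card {C \<in> Q. l C = t}"
  obtains \<beta> where "bij_betw \<beta> P Q" "\<And>C. C \<in> P \<Longrightarrow> l (\<beta> C) = l C"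
proof -
  have "\<exists>h. bij_betw h {C \<in> P. l C = t} {C \<in> Q. l C = t}" for t
    using assms by (intro finite_same_card_bij) auto
  then obtain h where h: "\<And>t. bij_betw (h t) {C \<in> P. l C = t} {C \<in> Q. l C = t}" by metis
  define \<beta> where "\<beta> C = h (l C) C" for C
  have \<beta>: "\<beta> C \<in> Q" "l (\<beta> C) = l C" if "C \<in> P" for C
    using bij_betw_apply[OF h[of "l C"], of C] that by (auto simp: \<beta>_def)
  have "inj_on \<beta> P"
  proof (rule inj_onI)
    fix C D assume CD: "C \<in> P" "D \<in> P" "\<beta> C = \<beta> D"
    then have "l C = l D" using \<beta>(2) by metis
    then show "C = D"
      using bij_betw_imp_inj_on[OF h[of "l D"]] CD by (auto simp: \<beta>_def dest: inj_onD)
  qed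
  moreover have "\<beta> ` P = Q"
  proof
    show "\<beta> ` P \<subseteq> Q" using \<beta>(1) by blast
    show "Q \<subseteq> \<beta> ` P"
    proof
      fix D assume "D \<in> Q"
      then have "D \<in> h (l D) ` {C \<in> P. l C = l D}" using bij_betw_imp_surj_on[OF h[of "l D"]] by simp
      then obtain C where "C \<in> P" "l C = l D" "D = h (l D) C" by blast
      then have "D = \<beta> C" by (simp add: \<beta>_def)
      then show "D \<in> \<beta> ` P" using \<open>C \<in> P\<close> by blast
    qed
  qed
  ultimately have "bij_betw \<beta> P Q" by (simp add: bij_betw_def)
  then show thesis using \<beta>(2) by (rule that)
qed

text \<open>The map \<open>f\<close> has to separate classes but may take several values on one
  class. Choosing one element of \<open>A\<close> per attained value reaches every class.\<close>

lemma card_quotient_le: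
  assumes eq: "equiv A r" and B: "finite B" "f ` A \<subseteq> B"
    and r: "\<And>x y. x \<in> A \<Longrightarrow> y \<in> A \<Longrightarrow> f x = f y \<Longrightarrow> (x, y) \<in> r"
  shows "card (A // r) \<le> card B"
proof -
  have "A // r \<subseteq> (\<lambda>b. r `` {SOME x. x \<in> A \<and> f x = b}) ` B"
  proof
    fix c assume "c \<in> A // r"
    then obtain x where x: "x \<in> A" "c = r `` {x}" by (auto elim: quotientE)
    define y where "y = (SOME y. y \<in> A \<and> f y = f x)"
    have "y \<in> A \<and> f y = f x" unfolding y_def by (rule someI[where x = x]) (simp add: x(1))
    then have "(x, y) \<in> r" using r[of x y] x(1) by simp
    then have "c = r `` {y}" using x(2) equiv_class_eq[OF eq] by simp
    then show "c \<in> (\<lambda>b. r `` {SOME x. x \<in> A \<and> f x = b}) ` B" using x(1) B(2) unfolding y_def by blast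
  qed
  then show ?thesis using B(1) by (rule surj_card_le[rotated])
qed

lemma card_small_subsets_le:
  assumes "finite V"
  shows "card {X. X \<subseteq> V \<and> card X \<le> m} \<le> (card V + 1) ^ m"
proof -
  let ?L = "{xs. set xs \<subseteq> V \<and> length xs \<le> m}"
  have "{X. X \<subseteq> V \<and> card X \<le> m} \<subseteq> set ` ?L"
  proof clarify
    fix X assume X: "X \<subseteq> V" "card X \<le> m"
    then obtain xs where "distinct xs" "set xs = X"
      using assms finite_distinct_list finite_subset by metis
    then show "X \<in> set ` ?L" using X distinct_card by fastforce
  qed
  then have "card {X. X \<subseteq> V \<and> card X \<le> m} \<le> card ?L"
    using finite_lists_length_le[OF assms] by (intro surj_card_le[of ?L _ set])
  then show ?thesis using card_lists_le[OF assms, of m] by linarith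
qed

text \<open>The three factors count the components of a signature: the set \<open>X\<close>, the
  multiplicities of the codes of components with at most \<open>s\<close> vertices, and the set of
  larger components inside \<open>W\<close>.\<close>

lemma card_good_pair_classes_le:
  fixes k s :: nat and V :: "'a set"
  defines "D \<equiv> 2 * card (boundary_labels (2 * k + 2)) + 2"
  assumes G: "simple_graph V E" and tw: "treewidth V E \<le> int k"
  shows "card (good_pairs k V E // good_pair_iso k V E) \<le>
    (card V + 1) ^ (k + 1) *
    ((card V + 1) ^ (D ^ ((2 * k + 5) * s + 1)) * 2 ^ (card V div (s + 1)))"
proof -
  let ?n = "card V"
  have finV: "finite V" using G by (simp add: simple_graph_def)
  define T where "T = codes_upto (boundary_labels (2 * k + 2)) ((2 * k + 5) * s + 1)"
  have T: "finite T" "card T \<le> D ^ ((2 * k + 5) * s + 1)"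
    unfolding T_def D_def by (rule codes_upto_finite_card[OF finite_boundary_labels])+
  define \<X> where "\<X> = {X. X \<subseteq> V \<and> card X \<le> k + 1}"
  have fin\<X>: "finite \<X>" using finV by (simp add: \<X>_def)
  define comps where "comps X = components E (V - X)" for X
  have fincomps: "finite (comps X)" for X using finV by (simp add: comps_def components_def)
  have compsV: "C \<subseteq> V - X" if "C \<in> comps X" for C X
    using components_eq(2)[of C E "V - X"] that unfolding comps_def by blast
  \<comment> \<open>One ordering per \<open>X\<close>, so that the codes of all components refer to
    the same boundary list and equal codes give isomorphisms fixing \<open>X\<close>.\<close>
  define enum where "enum X = (SOME xs. distinct xs \<and> set xs = X)" for X :: "'a set"
  have enum: "distinct (enum X)" "set (enum X) = X" if "X \<in> \<X>" for X
  proof -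
    have "finite X" using that finV by (auto simp: \<X>_def intro: finite_subset)
    then have "\<exists>xs. distinct xs \<and> set xs = X" using finite_distinct_list by blast
    then have "distinct (enum X) \<and> set (enum X) = X" unfolding enum_def by (rule someI_ex)
    then show "distinct (enum X)" "set (enum X) = X" by auto
  qed
  have "\<forall>X\<in>\<X>. \<forall>C\<in>comps X. \<exists>t. describes E t (enum X) (X \<union> C) \<and> (card C \<le> s \<longrightarrow> t \<in> T)"
  proof (intro ballI)
    fix X C assume X: "X \<in> \<X>" and C: "C \<in> comps X"
    have "(X \<union> C) - X = C" using compsV[OF C] by blast
    moreover have "X \<union> C \<subseteq> V" using compsV[OF C] X by (auto simp: \<X>_def)
    moreover have "card X \<le> k + 1" using X by (simp add: \<X>_def)
    ultimately obtain t where t: "describes E t (enum X) (X \<union> C)"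
      "t \<in> codes_upto (boundary_labels (2 * k + 2)) ((2 * k + 5) * card C + 1)"
      using code_exists[OF G tw Un_upper1 _ _ enum[OF X], of C] by auto
    have "t \<in> T" if "card C \<le> s"
    proof -
      have "(2 * k + 5) * card C \<le> (2 * k + 5) * s" using that by (rule mult_le_mono2)
      moreover have "set_code t \<subseteq> boundary_labels (2 * k + 2)" "code_length t \<le> (2 * k + 5) * card C + 1"
        using t(2) unfolding codes_upto_def by blast+
      ultimately show ?thesis unfolding T_def codes_upto_def by (blast intro: order_trans add_right_mono)
    qed
    then show "\<exists>t. describes E t (enum X) (X \<union> C) \<and> (card C \<le> s \<longrightarrow> t \<in> T)" using t(1) by blast
  qed
  then have "\<exists>code. \<forall>X\<in>\<X>. \<forall>C\<in>comps X.
      describes E (code X C) (enum X) (X \<union> C) \<and> (card C \<le> s \<longrightarrow> code X C \<in> T)"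
    unfolding bchoice_iff .
  then obtain code where code: "\<And>X C. X \<in> \<X> \<Longrightarrow> C \<in> comps X \<Longrightarrow> describes E (code X C) (enum X) (X \<union> C)"
    and codeT: "\<And>X C. X \<in> \<X> \<Longrightarrow> C \<in> comps X \<Longrightarrow> card C \<le> s \<Longrightarrow> code X C \<in> T"
    by blast
  define large where "large X = {C \<in> comps X. s + 1 \<le> card C}" for X
  define counts where "counts X W = (\<lambda>t\<in>T. card {C \<in> comps X. C \<subseteq> W \<and> card C \<le> s \<and> code X C = t})" for X W
  define sig where "sig = (\<lambda>(X, W). (X, counts X W, {C \<in> large X. C \<subseteq> W}))"
  define Sigs where "Sigs = (SIGMA X:\<X>. (T \<rightarrow>\<^sub>E {..?n}) \<times> Pow (large X))"
  have cardcomps: "card (comps X) \<le> ?n" for X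
    using card_image_le[of "V - X" "component E (V - X)"] card_mono[OF finV, of "V - X"] finV
    unfolding comps_def components_def by (meson Diff_subset finite_Diff order_trans)
  have finlarge: "finite (large X)" for X using fincomps by (simp add: large_def)
  have "card (good_pairs k V E // good_pair_iso k V E) \<le> card Sigs"
  proof (rule card_quotient_le[OF equiv_good_pair_iso, where f = sig])
    show "finite Sigs" unfolding Sigs_def
      using fin\<X> T(1) finlarge by (intro finite_SigmaI finite_cartesian_product finite_PiE) auto
    show "sig ` good_pairs k V E \<subseteq> Sigs"
    proof (rule image_subsetI)
      fix p assume "p \<in> good_pairs k V E"
      moreover obtain X W where p: "p = (X, W)" by (cases p)
      ultimately have "X \<in> \<X>" by (auto simp: good_pairs_def \<X>_def)
      moreover have "card {C \<in> comps X. C \<subseteq> W \<and> card C \<le> s \<and> code X C = t} \<le> ?n" for t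
        using card_mono[OF fincomps[of X], of "{C \<in> comps X. C \<subseteq> W \<and> card C \<le> s \<and> code X C = t}"]
          cardcomps[of X] by auto
      ultimately show "sig p \<in> Sigs" by (auto simp: p sig_def Sigs_def counts_def)
    qed
  next
    fix p q assume p: "p \<in> good_pairs k V E" and q: "q \<in> good_pairs k V E" and pq: "sig p = sig q"
    obtain X W where pX: "p = (X, W)" by (cases p)
    obtain X' Z where qX: "q = (X', Z)" by (cases q)
    have "X' = X" and cnt: "counts X W = counts X Z"
      and lrg: "{C \<in> large X. C \<subseteq> W} = {C \<in> large X. C \<subseteq> Z}"
      using pq by (auto simp: sig_def pX qX)
    have W: "(X, W) \<in> good_pairs k V E" and Z: "(X, Z) \<in> good_pairs k V E"
      using p q pX qX \<open>X' = X\<close> by auto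
    have X: "X \<in> \<X>" using W by (auto simp: good_pairs_def \<X>_def)
    define P where "P Y = {C \<in> comps X. C \<subseteq> Y}" for Y
    \<comment> \<open>Small components are identified up to their code, whereas a large one is its
      own label and is thus mapped to itself by \<open>\<beta>\<close>.\<close>
    define l where "l C = (if card C \<le> s then Inl (code X C) else Inr C)" for C
    have "card {C \<in> P W. l C = t} = card {C \<in> P Z. l C = t}" for t
    proof (cases t)
      case (Inl c)
      have eq: "{C \<in> P Y. l C = t} = {C \<in> comps X. C \<subseteq> Y \<and> card C \<le> s \<and> code X C = c}" for Y
        using Inl by (auto simp: P_def l_def)
      show ?thesis
      proof (cases "c \<in> T")
        case True
        then show ?thesis using fun_cong[OF cnt, of c] by (simp add: eq counts_def)
      next
        case False
        \<comment> \<open>Codes of small components always lie in \<open>T\<close>, so for other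
          codes both counts are zero.\<close>
        then have "{C \<in> comps X. C \<subseteq> Y \<and> card C \<le> s \<and> code X C = c} = {}" for Y
          using codeT[OF X] by blast
        then show ?thesis by (simp only: eq)
      qed
    next
      case (Inr c)
      have "{C \<in> P Y. l C = t} = {C \<in> large X. C \<subseteq> Y} \<inter> {c}" for Y
        using Inr by (auto simp: P_def l_def large_def)
      then show ?thesis using lrg by simp
    qed
    then obtain \<beta> where \<beta>: "bij_betw \<beta> (P W) (P Z)" "\<And>C. C \<in> P W \<Longrightarrow> l (\<beta> C) = l C"
      using bij_betw_preserving_labels[of "P W" "P Z" l] fincomps by (auto simp: P_def)
    have "((X, W), (X, Z)) \<in> good_pair_iso k V E"
    proof (rule good_pair_iso_by_components[OF W Z])
      show "bij_betw \<beta> {C \<in> components E (V - X). C \<subseteq> W} {C \<in> components E (V - X). C \<subseteq> Z}"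
        using \<beta>(1) by (simp add: P_def comps_def)
      fix C assume "C \<in> components E (V - X)" "C \<subseteq> W"
      then have C: "C \<in> comps X" "C \<in> P W" by (auto simp: comps_def P_def)
      have \<beta>C: "\<beta> C \<in> comps X" using bij_betw_apply[OF \<beta>(1) C(2)] by (simp add: P_def)
      have "code X (\<beta> C) = code X C"
        using \<beta>(2)[OF C(2)] by (auto simp: l_def split: if_splits)
      then obtain f where f: "graph_iso E f (X \<union> C) (X \<union> \<beta> C)" "map f (enum X) = enum X"
        using describes_unique_iso[OF code[OF X C(1)]] code[OF X \<beta>C] by metis
      moreover have "f v = v" if "v \<in> X" for v
        using f(2) enum(2)[OF X] that by (metis map_eq_conv map_ident)
      ultimately show "\<exists>f. graph_iso E f (X \<union> C) (X \<union> \<beta> C) \<and> (\<forall>v\<in>X. f v = v)" by blast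
    qed
    then show "(p, q) \<in> good_pair_iso k V E" using pX qX \<open>X' = X\<close> by simp
  qed
  also have "card Sigs \<le> card \<X> * ((?n + 1) ^ card T * 2 ^ (?n div (s + 1)))"
  proof -
    have "card Sigs = (\<Sum>X\<in>\<X>. card ((T \<rightarrow>\<^sub>E {..?n}) \<times> Pow (large X)))"
      unfolding Sigs_def using fin\<X> T(1) finlarge
      by (intro card_SigmaI) (auto intro: finite_PiE)
    also have "\<dots> \<le> (\<Sum>X\<in>\<X>. (?n + 1) ^ card T * 2 ^ (?n div (s + 1)))"
    proof (rule sum_mono)
      fix X assume "X \<in> \<X>"
      have "card (large X) * (s + 1) \<le> card (V - X)"
        using card_components_ge[of "V - X" E "s + 1"] finV by (simp add: large_def comps_def)
      also have "\<dots> \<le> ?n" using finV by (simp add: card_mono)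
      finally have "card (large X) \<le> ?n div (s + 1)"
        by (simp add: less_eq_div_iff_mult_less_eq)
      then have "(2 :: nat) ^ card (large X) \<le> 2 ^ (?n div (s + 1))" by (rule power_increasing) simp
      then show "card ((T \<rightarrow>\<^sub>E {..?n}) \<times> Pow (large X)) \<le> (?n + 1) ^ card T * 2 ^ (?n div (s + 1))"
        using T(1) finlarge by (simp add: card_cartesian_product card_PiE card_Pow)
    qed
    finally show ?thesis by simp
  qed
  also have "\<dots> \<le> (?n + 1) ^ (k + 1) * ((?n + 1) ^ (D ^ ((2 * k + 5) * s + 1)) * 2 ^ (?n div (s + 1)))"
    using card_small_subsets_le[OF finV, of "k + 1"] T(2)
    by (intro mult_le_mono power_increasing) (auto simp: \<X>_def)
  finally show ?thesis .
qed

section \<open>Choice of the size threshold and the asymptotic estimate\<close>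

text \<open>The function \<open>g\<close> is fixed before the graph, so the bound is uniform over
  all graphs with the same number of vertices.\<close>

theorem theorem1:
  fixes k :: nat
  shows "\<exists>g :: nat \<Rightarrow> real. g \<in> O(\<lambda>n. real n / ln (real n)) \<and>
           (\<forall>(V :: 'a set) E. simple_graph V E \<longrightarrow> treewidth V E \<le> int k \<longrightarrow>
              real (card (good_pairs k V E // good_pair_iso k V E)) \<le> 2 powr g (card V))"
proof -
  define D where "D = 2 * card (boundary_labels (2 * k + 2)) + 2"
  define a where "a = 2 * k + 5"
  \<comment> \<open>Chosen so that \<open>D ^ (a * s)\<close> is at most
    \<open>exp (ln n / 2)\<close>, the square root of \<open>n\<close>, whenever \<open>s\<close> is
    at most \<open>\<delta> * ln n\<close>.\<close>
  define \<delta> where "\<delta> = 1 / (2 * real a * ln (real D))"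
  have D: "ln (real D) > 0" by (simp add: D_def)
  have a: "real a > 0" by (simp add: a_def)
  have \<delta>: "\<delta> > 0" using D a by (simp add: \<delta>_def)
  define c where "c = 1 / \<delta>"
  have c: "c > 0" using \<delta> by (simp add: c_def)
  \<comment> \<open>The first three summands bound the logarithms of the three factors of the
    counting lemma; the final \<open>1\<close> is for \<open>n \<le> 1\<close>.\<close>
  define g where "g n = (real k + 1) * log 2 (real n + 1)
    + real D * ((sqrt (real n) + 1) * log 2 (real n + 1)) + c * (real n / ln (real n)) + 1" for n :: nat
  have "g \<in> O(\<lambda>n. real n / ln (real n))"
  proof -
    have cmult: "(\<lambda>n. b * f n) \<in> O(h)" if "f \<in> O(h)" for b and f h :: "nat \<Rightarrow> real"
      using that by (cases "b = 0") simp_all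
    have "(\<lambda>n. log 2 (real n + 1)) \<in> O(\<lambda>n. real n / ln (real n))"
      "(\<lambda>n. (sqrt (real n) + 1) * log 2 (real n + 1)) \<in> O(\<lambda>n. real n / ln (real n))"
      "(\<lambda>n. 1 :: real) \<in> O(\<lambda>n. real n / ln (real n))"
      by real_asymp+
    then show ?thesis unfolding g_def by (intro sum_in_bigo cmult) simp_all
  qed
  moreover have "real (card (good_pairs k V E // good_pair_iso k V E)) \<le> 2 powr g (card V)"
    if G: "simple_graph V E" "treewidth V E \<le> int k" for V :: "'a set" and E
  proof -
    define n where "n = card V"
    \<comment> \<open>Rounding down bounds the number of small codes, while \<open>s + 1\<close> is
      still at least \<open>\<delta> * ln n\<close>, as the bound on large components
      requires.\<close>
    define s where "s = nat \<lfloor>\<delta> * ln (real n)\<rfloor>"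
    have ln0: "ln (real n) \<ge> 0" by (cases "n = 0") auto
    have s: "real s \<le> \<delta> * ln (real n)" "\<delta> * ln (real n) \<le> real s + 1"
      using ln0 \<delta> by (auto simp: s_def)
    have Ds: "real (D ^ (a * s + 1)) \<le> real D * (sqrt (real n) + 1)"
    proof -
      have "real (D ^ (a * s)) = exp (real (a * s) * ln (real D))"
        unfolding exp_of_nat_mult by (simp add: D_def)
      also have "\<dots> \<le> exp (ln (real n) / 2)"
      proof -
        have "real (a * s) * ln (real D) \<le> real a * (\<delta> * ln (real n)) * ln (real D)"
          using s(1) a D by (simp add: mult_left_mono mult_right_mono)
        also have "\<dots> = ln (real n) / 2" using a D by (simp add: \<delta>_def)
        finally show ?thesis by simp
      qed
      \<comment> \<open>The summand \<open>1\<close> covers \<open>n = 0\<close>, where the root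
        vanishes.\<close>
      also have "\<dots> \<le> sqrt (real n) + 1"
      proof (cases "n = 0")
        case False
        then have "exp (ln (real n) / 2) = sqrt (real n)" by (simp flip: ln_sqrt)
        then show ?thesis by simp
      qed simp
      finally show ?thesis by (simp add: mult_left_mono)
    qed
    have ns: "real (n div (s + 1)) \<le> c * (real n / ln (real n)) + 1"
    proof (cases "n \<le> 1")
      \<comment> \<open>Here \<open>n / ln n\<close> evaluates to \<open>0\<close>, for
        \<open>n = 1\<close> by division by zero, so the summand \<open>1\<close> carries the
        bound.\<close>
      case True
      then have "n div (s + 1) \<le> 1" using div_le_dividend le_trans by blast
      moreover have "0 \<le> c * (real n / ln (real n))" using c ln0 by simp
      ultimately show ?thesis by linarith
    next
      case False
      then have pos: "ln (real n) > 0" by simp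
      have "real (n div (s + 1)) \<le> real n / real (s + 1)" by (rule of_nat_div_le_of_nat)
      also have "\<dots> \<le> real n / (\<delta> * ln (real n))"
        using s(2) pos \<delta> by (intro divide_left_mono) auto
      finally show ?thesis by (simp add: c_def)
    qed
    have pw: "(real n + 1) ^ m = 2 powr (real m * log 2 (real n + 1))" for m
      by (simp add: powr_mult_base powr_powr[symmetric] powr_realpow mult.commute[of "real m"])
    have "real (card (good_pairs k V E // good_pair_iso k V E)) \<le>
        real ((n + 1) ^ (k + 1) * ((n + 1) ^ (D ^ (a * s + 1)) * 2 ^ (n div (s + 1))))"
      using card_good_pair_classes_le[OF G, of s] unfolding n_def D_def a_def by (rule of_nat_mono)
    also have "\<dots> = 2 powr (real (k + 1) * log 2 (real n + 1) +
        (real (D ^ (a * s + 1)) * log 2 (real n + 1) + real (n div (s + 1))))"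
      by (simp only: powr_add of_nat_mult of_nat_power of_nat_add of_nat_1 of_nat_numeral pw
            powr_realpow[of 2, simplified])
    also have "\<dots> \<le> 2 powr g n"
    proof -
      have "real (D ^ (a * s + 1)) * log 2 (real n + 1) \<le>
          real D * (sqrt (real n) + 1) * log 2 (real n + 1)"
        using Ds by (rule mult_right_mono) simp
      then show ?thesis using ns by (simp add: g_def algebra_simps)
    qed
    finally show ?thesis by (simp add: n_def)
  qed
  ultimately show ?thesis by blast
qed

end
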